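(* Let $A_{5,5}=\{12354,12453,13452,23451\}$. The generating function $\sum_{n\geq 0}|\operatorname{Av}_n(A_{5,5})|z^n$ is not algebraic.
   Context: A permutation $p=p_1\cdots p_n$ contains a pattern $q=q_1\cdots q_k$ if there are indices $i_1<\cdots<i_k$ with $p_{i_r}<p_{i_s}$ iff $q_r<q_s$; otherwise $p$ avoids $q$. $\operatorname{Av}_n(S)$ is the set of permutations of length $n$ avoiding every pattern in the set $S$. A power series $A(z)$ is algebraic if there are polynomials $P_0(z),\dots,P_d(z)$, not all identically zero, with $\sum_{j=0}^d P_j(z)A(z)^j=0$. *)

theory Defs
  imports Complex_Main
    "HOL-Combinatorics.Multiset_Permutations"
    "HOL-Computational_Algebra.Polynomial_FPS"
begin

text \<open>
  A permutation $p_1 \cdots p_n$ is the list of its values, i.e. an element of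
  \<^term>\<open>permutations_of_set {1..n}\<close>. List positions are counted from 0.
\<close>

definition contains_pattern :: "nat list \<Rightarrow> nat list \<Rightarrow> bool" where
  "contains_pattern p q \<longleftrightarrow>
     (\<exists>i :: nat \<Rightarrow> nat. strict_mono_on {..<length q} i
        \<and> (\<forall>r<length q. i r < length p)
        \<and> (\<forall>r<length q. \<forall>s<length q. p ! i r < p ! i s \<longleftrightarrow> q ! r < q ! s))"

definition Av :: "nat \<Rightarrow> nat list set \<Rightarrow> nat list set" where
  "Av n S = {p \<in> permutations_of_set {1..n}. \<forall>q\<in>S. \<not> contains_pattern p q}"

definition Av_gf :: "nat list set \<Rightarrow> complex fps" where
  "Av_gf S = Abs_fps (\<lambda>n. of_nat (card (Av n S)))"

definition fps_algebraic :: "'a :: field fps \<Rightarrow> bool" where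
  "fps_algebraic A \<longleftrightarrow>
     (\<exists>(d :: nat) (P :: nat \<Rightarrow> 'a poly).
        (\<exists>j\<le>d. P j \<noteq> 0) \<and> (\<Sum>j\<le>d. fps_of_poly (P j) * A ^ j) = 0)"

definition A55 :: "nat list set" where
  "A55 = {[1,2,3,5,4], [1,2,4,5,3], [1,3,4,5,2], [2,3,4,5,1]}"

end

theory Submission
  imports Defs
    "HOL-Library.Sublist"
    "HOL-Library.Infinite_Set"
    "HOL-Computational_Algebra.Formal_Laurent_Series"
    "HOL-Analysis.FPS_Convergence"
begin

text \<open>
  A permutation avoids \<^term>\<open>A55\<close> iff every entry that ends an increasing subsequence of length 4
  is smaller than all later entries. Such a permutation is a 1234-avoiding prefix followed by an
  increasing tail, whence $T_{n-1} \le |Av_n| \le T_n$ with $T_n = \sum_m {n \choose m} S_m$, where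
  $S_m$ counts the 1234-avoiding permutations. If $S_m$ has the order of $9^m / m^4$, then $|Av_n|$ has
  the order of $10^n / n^4$. After subtraction of its quadratic Taylor polynomial at $1/10$ and division
  by $(1 - 10z)^3$, the generating function therefore tends to infinity at $1/10$, but more slowly than
  any power of $1/(1 - 10z)$. An algebraic function cannot do that.

  The estimate of $S_m$ comes from the generating tree of 1234-avoiding permutations (insertion of the
  maximum). Its functional equation has a kernel that is symmetric in three variables $x, y, z$ after a
  change of variables, and antisymmetrisation cancels the boundary terms. Coefficient extraction yields
  $S_n = \sum_j C_j ({n \choose j}^2 - {n \choose j}{n \choose j-1} + {n \choose j-1}{n \choose j+1})$
  with the Catalan numbers $C_j$, creative telescoping turns this into a recurrence of order 2,
  and the recurrence bounds the ratios $S_{n+1} / S_n$.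
\<close>

section \<open>The generating tree of 1234-avoiding permutations\<close>

text \<open>Rescaled coefficients of order n^(-4) belong to a singular term of exponent 3. In a
  Puiseux expansion an integer exponent produces no singularity, so a factor log(1 - w) has to
  accompany (1 - w)^3. The criterion at the end asks only for divergence and for growth below every
  power, not for an asymptotic formula. The exponent 4, however, must be exact. The growth rate 9
  alone would not give it, which is why a recurrence with polynomial coefficients is derived and its
  ratios are bounded by quotients with the correct 1/n term. The base 10 is 9 + 1 in the binomial
  theorem.\<close>

definition has_inc :: "nat \<Rightarrow> nat list \<Rightarrow> bool" where
  "has_inc k xs \<longleftrightarrow> (\<exists>ys. subseq ys xs \<and> sorted_wrt (<) ys \<and> length ys = k)"

lemma has_inc_mono: "has_inc k xs \<Longrightarrow> subseq xs ys \<Longrightarrow> has_inc k ys"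
  unfolding has_inc_def using subseq_order.order_trans by blast

lemma has_inc_Suc_imp: "has_inc (Suc k) xs \<Longrightarrow> has_inc k xs"
  unfolding has_inc_def
proof (elim exE conjE)
  fix ys assume ys: "subseq ys xs" "sorted_wrt (<) ys" "length ys = Suc k"
  then obtain y zs where yz: "ys = y # zs" by (cases ys) auto
  have "subseq zs xs" using ys(1) yz subseq_Cons' by metis
  then show "\<exists>ys. subseq ys xs \<and> sorted_wrt (<) ys \<and> length ys = k"
    using ys yz by auto
qed

lemma has_inc_take_mono: "has_inc k (take i xs) \<Longrightarrow> i \<le> j \<Longrightarrow> has_inc k (take j xs)"
  using has_inc_mono[of k "take i xs" "take j xs"] prefix_imp_subseq[OF take_is_prefix[of i "take j xs"]]
  by (simp add: min_absorb1)

lemma subseq_set_subset: "subseq xs ys \<Longrightarrow> set xs \<subseteq> set ys"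
  by (auto elim: list_emb_set)

text \<open>The maximum can only be the last entry of an increasing subsequence, so what precedes it
  there lies in \<open>xs\<close>.\<close>

lemma has_inc_insert_max:
  assumes "\<forall>x\<in>set xs. x < M" "\<forall>y\<in>set ys. y < M"
  shows "has_inc (Suc k) (xs @ M # ys) \<longleftrightarrow> has_inc (Suc k) (xs @ ys) \<or> has_inc k xs"
proof
  assume "has_inc (Suc k) (xs @ M # ys)"
  then obtain zs where zs: "subseq zs (xs @ M # ys)" "sorted_wrt (<) zs" "length zs = Suc k"
    unfolding has_inc_def by blast
  then obtain z1 z2 where z: "zs = z1 @ z2" "subseq z1 xs" "subseq z2 (M # ys)"
    unfolding subseq_append_iff by blast
  show "has_inc (Suc k) (xs @ ys) \<or> has_inc k xs"
  proof (cases "subseq z2 ys")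
    case True
    then have "subseq zs (xs @ ys)" unfolding z(1) by (intro list_emb_append_mono z(2))
    then have "has_inc (Suc k) (xs @ ys)" using zs(2,3) unfolding has_inc_def by blast
    then show ?thesis by simp
  next
    case False
    then obtain c z3 where c: "z2 = c # z3" by (cases z2) auto
    then have "c = M" "subseq z3 ys"
      using z(3) False unfolding c subseq_Cons2_iff by (simp_all split: if_splits)
    then have z3: "zs = z1 @ M # z3" using c z(1) by simp
    have s: "sorted_wrt (<) z1" "\<forall>w\<in>set z3. M < w"
      using zs(2) unfolding z3 sorted_wrt_append sorted_wrt.simps by simp_all
    have "set z3 \<subseteq> set ys" using \<open>subseq z3 ys\<close> by (rule subseq_set_subset)
    have "set z3 = {}"
    proof (rule equals0I)
      fix w assume w: "w \<in> set z3"
      then have "w < M" using \<open>set z3 \<subseteq> set ys\<close> assms(2) by blast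
      moreover have "M < w" using w s(2) by blast
      ultimately show False by simp
    qed
    then have "length z1 = k" using zs(3) unfolding z3 by simp
    then have "has_inc k xs" unfolding has_inc_def using z(2) s(1) by blast
    then show ?thesis by simp
  qed
next
  assume "has_inc (Suc k) (xs @ ys) \<or> has_inc k xs"
  then show "has_inc (Suc k) (xs @ M # ys)"
  proof
    assume "has_inc (Suc k) (xs @ ys)"
    moreover have "subseq (xs @ ys) (xs @ M # ys)" by (intro list_emb_append_mono) auto
    ultimately show ?thesis by (rule has_inc_mono)
  next
    assume "has_inc k xs"
    then obtain zs where zs: "subseq zs xs" "sorted_wrt (<) zs" "length zs = k"
      unfolding has_inc_def by blast
    have "\<forall>z\<in>set zs. z < M"
      using subseq_set_subset[OF zs(1)] assms(1) by blast
    then have "sorted_wrt (<) (zs @ [M])" using zs(2) by (simp add: sorted_wrt_append)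
    moreover have "subseq (zs @ [M]) (xs @ M # ys)"
      by (intro list_emb_append_mono zs(1)) simp
    moreover have "length (zs @ [M]) = Suc k" using zs(3) by simp
    ultimately show ?thesis unfolding has_inc_def by blast
  qed
qed

lemma nat_eq_if_less_iff:
  assumes "\<And>j::nat. j < a \<longleftrightarrow> j < b"
  shows "a = b"
  using assms[of a] assms[of b] by simp

text \<open>
  The positions where a new maximum can be inserted without creating an increasing subsequence of
  length \<open>k + 1\<close> are exactly those below \<open>site k p\<close>, counted from 0 to \<open>length p\<close>.
\<close>

definition site :: "nat \<Rightarrow> nat list \<Rightarrow> nat" where
  "site k p = (LEAST i. length p < i \<or> has_inc k (take i p))"

lemma less_site_iff: "i < site k p \<longleftrightarrow> i \<le> length p \<and> \<not> has_inc k (take i p)"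
proof
  assume "i < site k p"
  then have "\<not> (length p < i \<or> has_inc k (take i p))"
    unfolding site_def by (rule not_less_Least)
  then show "i \<le> length p \<and> \<not> has_inc k (take i p)" by auto
next
  assume *: "i \<le> length p \<and> \<not> has_inc k (take i p)"
  have "length p < site k p \<or> has_inc k (take (site k p) p)"
    unfolding site_def by (rule LeastI[of _ "Suc (length p)"]) simp
  then show "i < site k p"
    using * has_inc_take_mono by (meson leI order.strict_trans1)
qed

lemma site_le: "site k p \<le> Suc (length p)"
  unfolding site_def by (rule Least_le) simp

lemma site_mono: "site k p \<le> site (Suc k) p"
proof (rule ccontr)
  assume "\<not> site k p \<le> site (Suc k) p"
  then have "site (Suc k) p < site k p" by simp
  then have "site (Suc k) p < site (Suc k) p"
    using has_inc_Suc_imp unfolding less_site_iff by blast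
  then show False by simp
qed

text \<open>Every nonempty prefix has an increasing subsequence of length 1. Since this statistic is
  constant, only \<open>site 2\<close> and \<open>site 3\<close> have to be tracked when length 4 is
  forbidden.\<close>

lemma site_1: "site 1 p = 1"
proof -
  have "i < site 1 p \<longleftrightarrow> i < 1" for i
  proof (cases "i = 0 \<or> p = []")
    case True
    then show ?thesis by (auto simp: less_site_iff has_inc_def)
  next
    case False
    then have "subseq [hd p] (take i p)"
      by (cases p; cases i) (auto simp: subseq_singleton_left)
    then have "has_inc 1 (take i p)" unfolding has_inc_def by (intro exI[of _ "[hd p]"]) auto
    then show ?thesis using False by (auto simp: less_site_iff)
  qed
  then show ?thesis by (rule nat_eq_if_less_iff)
qed

lemma site_pos: "k \<ge> 1 \<Longrightarrow> site k p \<ge> 1"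
proof (induction k rule: dec_induct)
  case base show ?case using site_1[of p] by simp
next
  case (step n) then show ?case using site_mono order_trans by blast
qed

definition ins :: "nat \<Rightarrow> 'a \<Rightarrow> 'a list \<Rightarrow> 'a list" where
  "ins i M p = take i p @ M # drop i p"

lemma length_ins [simp]: "length (ins i M p) = Suc (length p)"
  by (simp add: ins_def)

lemma has_inc_ins:
  assumes "\<forall>x\<in>set p. x < M"
  shows "has_inc (Suc k) (ins i M p) \<longleftrightarrow> has_inc (Suc k) p \<or> has_inc k (take i p)"
  unfolding ins_def using assms
  by (subst has_inc_insert_max) (auto dest: in_set_takeD in_set_dropD)

lemma take_ins_le: "j \<le> i \<Longrightarrow> i \<le> length p \<Longrightarrow> take j (ins i M p) = take j p"
  by (simp add: ins_def min_def)

lemma take_ins_gt: "i < j \<Longrightarrow> i \<le> length p \<Longrightarrow> take j (ins i M p) = ins i M (take (j - 1) p)"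
  by (cases j) (auto simp: ins_def min_def take_Suc_Cons Suc_diff_le drop_take)

text \<open>Below \<open>site k p\<close> the new maximum completes no increasing subsequence of
  length k + 1, so all sites survive and the new entry adds one. Otherwise every prefix that
  contains the new entry is spoiled, and only the positions 0 to i can remain.\<close>

lemma site_ins:
  assumes M: "\<forall>x\<in>set p. x < M" and i: "i \<le> length p"
  shows "site (Suc k) (ins i M p) =
    (if i < site k p then Suc (site (Suc k) p) else min (Suc i) (site (Suc k) p))"
    (is "?l = ?r")
proof -
  have gt: "has_inc (Suc k) (take j (ins i M p)) \<longleftrightarrow>
      has_inc (Suc k) (take (j - 1) p) \<or> has_inc k (take i p)" if "i < j" for j
  proof -
    have "\<forall>x\<in>set (take (j - 1) p). x < M" using M by (auto dest: in_set_takeD)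
    moreover have "min i (j - 1) = i" using that by simp
    ultimately show ?thesis
      using has_inc_ins[of "take (j - 1) p" M k i] that i by (simp add: take_ins_gt)
  qed
  have "j < ?l \<longleftrightarrow> j < ?r" for j
  proof (cases "j \<le> i")
    case True
    then have l: "j < ?l \<longleftrightarrow> j < site (Suc k) p"
      using i by (simp add: less_site_iff take_ins_le)
    have "j < site (Suc k) p" if "i < site k p"
      using True that site_mono[of k p] by linarith
    then show ?thesis unfolding l using True by (cases "i < site k p") simp_all
  next
    case False
    then have j: "i < j" by simp
    have "j < ?l \<longleftrightarrow> j \<le> Suc (length p) \<and> \<not> has_inc (Suc k) (take (j - 1) p) \<and> \<not> has_inc k (take i p)"
      unfolding less_site_iff gt[OF j] by simp
    also have "\<dots> \<longleftrightarrow> j - 1 < site (Suc k) p \<and> i < site k p"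
      unfolding less_site_iff using i by (simp add: le_diff_conv)
    also have "\<dots> \<longleftrightarrow> j < ?r"
    proof (cases "i < site k p")
      case True
      then show ?thesis using j by (simp add: less_diff_conv2)
    next
      case False
      then show ?thesis using j by simp
    qed
    finally show ?thesis .
  qed
  then show ?thesis by (rule nat_eq_if_less_iff)
qed

section \<open>The levels of the tree and their functional equation\<close>

definition inc_avoiders :: "nat \<Rightarrow> nat \<Rightarrow> nat list set" where
  "inc_avoiders k n = {p \<in> permutations_of_set {1..n}. \<not> has_inc k p}"

lemma finite_inc_avoiders [simp]: "finite (inc_avoiders k n)"
  by (simp add: inc_avoiders_def)

lemma inc_avoidersD:
  assumes "p \<in> inc_avoiders k n"
  shows "set p = {1..n}" "distinct p" "length p = n" "\<not> has_inc k p" "\<forall>x\<in>set p. x < Suc n"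
proof -
  show s: "set p = {1..n}" and d: "distinct p" and "\<not> has_inc k p"
    using assms by (simp_all add: inc_avoiders_def permutations_of_set_def)
  show "length p = n" using distinct_card[OF d] s by simp
  show "\<forall>x\<in>set p. x < Suc n" using s by auto
qed

lemma inc_avoiders_0: "k > 0 \<Longrightarrow> inc_avoiders k 0 = {[]}"
  by (auto simp: inc_avoiders_def has_inc_def)

text \<open>Deleting the maximum inverts the insertion, so a node \<open>p\<close> of the tree has
  exactly \<open>site k p\<close> children.\<close>

lemma bij_betw_ins:
  "bij_betw (\<lambda>(p, i). ins i (Suc n) p)
     (SIGMA p : inc_avoiders (Suc k) n. {..<site k p}) (inc_avoiders (Suc k) (Suc n))"
  (is "bij_betw ?f ?A ?B")
proof (rule bij_betw_imageI)
  show "inj_on ?f ?A"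
  proof (rule inj_onI, clarsimp)
    fix p i q j
    assume p: "p \<in> inc_avoiders (Suc k) n" "i < site k p"
      and q: "q \<in> inc_avoiders (Suc k) n" "j < site k q"
      and eq: "ins i (Suc n) p = ins j (Suc n) q"
    have "Suc n \<notin> set p" "Suc n \<notin> set q" using inc_avoidersD(1)[OF p(1)] inc_avoidersD(1)[OF q(1)] by auto
    then have "Suc n \<notin> set (take i p)" "Suc n \<notin> set (take j q)" 
        "Suc n \<notin> set (drop i p)"
      using in_set_takeD in_set_dropD by fast+
    from append_Cons_eq_iff[OF this(1,3)] have "take i p = take j q \<and> drop i p = drop j q"
      using eq unfolding ins_def by blast
    then have td: "take i p = take j q" "drop i p = drop j q" by auto
    have "take i p @ drop i p = take j q @ drop j q" unfolding td ..
    moreover have "length (take i p) = length (take j q)" unfolding td ..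
    moreover have "i \<le> length p" "j \<le> length q" using p(2) q(2) by (simp_all add: less_site_iff)
    ultimately show "p = q \<and> i = j" by simp
  qed
  show "?f ` ?A = ?B"
  proof (intro equalityI subsetI)
    fix r assume "r \<in> ?f ` ?A"
    then obtain p i where p: "p \<in> inc_avoiders (Suc k) n" "i < site k p" and r: "r = ins i (Suc n) p"
      by auto
    have "\<not> has_inc (Suc k) r"
      using p r inc_avoidersD[OF p(1)] by (simp add: has_inc_ins less_site_iff)
    moreover have "set r = {1..Suc n}" 
    proof -
      have "set r = insert (Suc n) (set (take i p @ drop i p))"
        unfolding r ins_def set_append list.set by (simp only: Un_insert_right)
      then show ?thesis using inc_avoidersD(1)[OF p(1)] by auto
    qed
    moreover have "distinct r"
    proof -
      define xs ys where "xs = take i p" and "ys = drop i p"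
      have p': "p = xs @ ys" by (simp add: xs_def ys_def)
      have "distinct (xs @ ys)" using inc_avoidersD(2)[OF p(1)] by (simp add: p')
      moreover have "Suc n \<notin> set (xs @ ys)" using inc_avoidersD(1)[OF p(1)] by (simp add: p')
      ultimately show ?thesis unfolding r ins_def xs_def[symmetric] ys_def[symmetric] by auto
    qed
    ultimately show "r \<in> ?B" by (simp add: inc_avoiders_def permutations_of_set_def)
  next
    fix r assume r: "r \<in> ?B"
    then have "Suc n \<in> set r" using inc_avoidersD(1)[OF r] by auto
    then obtain xs ys where xy: "r = xs @ Suc n # ys" by (meson split_list)
    define p where "p = xs @ ys"
    have rp: "r = ins (length xs) (Suc n) p" by (simp add: p_def xy ins_def)
    have d: "distinct p" "Suc n \<notin> set p" using inc_avoidersD(2)[OF r] by (auto simp: xy p_def)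
    have s: "set p = {1..n}"
    proof -
      have "insert (Suc n) (set p) = insert (Suc n) {1..n}"
        using inc_avoidersD(1)[OF r] atLeastAtMostSuc_conv[of 1 n] by (simp add: xy p_def)
      then show ?thesis using d(2) by (metis Diff_insert_absorb Suc_n_not_le_n atLeastAtMost_iff)
    qed
    have "\<not> has_inc (Suc k) p \<and> \<not> has_inc k (take (length xs) p)"
      using inc_avoidersD(4)[OF r] s unfolding rp by (subst (asm) has_inc_ins) auto
    then have "p \<in> inc_avoiders (Suc k) n" "length xs < site k p"
      using d s by (auto simp: inc_avoiders_def permutations_of_set_def less_site_iff p_def)
    then show "r \<in> ?f ` ?A" using rp by (intro image_eqI[of _ _ "(p, length xs)"]) auto
  qed
qed

lemma sum_inc_avoiders_Suc:
  "(\<Sum>r\<in>inc_avoiders (Suc k) (Suc n). f r) =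
   (\<Sum>p\<in>inc_avoiders (Suc k) n. \<Sum>i<site k p. f (ins i (Suc n) p))"
  by (subst sum.Sigma) (auto simp: sum.reindex_bij_betw[OF bij_betw_ins, symmetric] case_prod_unfold)

definition site_poly :: "nat \<Rightarrow> 'a \<Rightarrow> 'a \<Rightarrow> 'a::field" where
  "site_poly n u v = (\<Sum>p\<in>inc_avoiders 4 n. u ^ site 2 p * v ^ site 3 p)"

lemma site_nil: "k > 0 \<Longrightarrow> site k [] = 1"
proof -
  assume "k > 0"
  have "i < site k [] \<longleftrightarrow> i < 1" for i using \<open>k > 0\<close> by (auto simp: less_site_iff has_inc_def)
  then show ?thesis by (rule nat_eq_if_less_iff)
qed

lemma site_poly_0: "site_poly 0 u v = u * v"
  by (simp add: site_poly_def inc_avoiders_0 site_nil)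

lemma geometric_shift:
  fixes u :: "'a::field"
  assumes "a \<le> b" "u \<noteq> 1"
  shows "(\<Sum>i=a..<b. u ^ Suc i) = (u ^ Suc b - u ^ Suc a) / (u - 1)"
  using assms by (induction b rule: dec_induct) (auto simp: field_simps)

text \<open>The two runs of insertion positions give geometric sums in u and in v. Their upper ends
  produce the kernel, their lower ends the two boundary terms, in which u or v is
  specialised.\<close>

lemma site_poly_Suc:
  fixes u v :: "'a::field"
  assumes "u \<noteq> 1" "v \<noteq> 1"
  shows "site_poly (Suc n) u v = (u\<^sup>2 * v / (u - 1) + v / (v - 1)) * site_poly n u v
     - u\<^sup>2 * v / (u - 1) * site_poly n 1 v - v / (v - 1) * site_poly n (u * v) 1"
proof -
  have step: "(\<Sum>i<site 3 p. u ^ site 2 (ins i (Suc n) p) * v ^ site 3 (ins i (Suc n) p)) =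
      (u\<^sup>2 * v / (u - 1) + v / (v - 1)) * (u ^ site 2 p * v ^ site 3 p)
     - u\<^sup>2 * v / (u - 1) * (1 ^ site 2 p * v ^ site 3 p) - v / (v - 1) * ((u * v) ^ site 2 p * 1 ^ site 3 p)"
    if p: "p \<in> inc_avoiders 4 n" for p
  proof -
    define a b where "a = site 2 p" and "b = site 3 p"
    have ab: "1 \<le> a" "a \<le> b" "b \<le> Suc (length p)"
      using site_pos[of 2 p] site_mono[of 2 p] site_le[of 3 p] by (auto simp: a_def b_def numeral_eq_Suc)
    have s2: "site 2 (ins i (Suc n) p) = (if i < 1 then Suc a else min (Suc i) a)"
     and s3: "site 3 (ins i (Suc n) p) = (if i < a then Suc b else min (Suc i) b)" if "i < b" for i
      using site_ins[OF inc_avoidersD(5)[OF p], of i 1] site_ins[OF inc_avoidersD(5)[OF p], of i 2] that ab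
      by (auto simp: a_def b_def numeral_eq_Suc site_1[unfolded One_nat_def])
    \<comment> \<open>Position 0 raises both statistics. Positions from 1 to a - 1 set
      \<open>site 2\<close> to i + 1 and raise \<open>site 3\<close>; positions from a to b - 1 keep
      \<open>site 2\<close> and set \<open>site 3\<close> to i + 1.\<close>
    have "{..<b} = insert 0 ({1..<a} \<union> {a..<b})" using ab by auto
    then have "(\<Sum>i<b. u ^ site 2 (ins i (Suc n) p) * v ^ site 3 (ins i (Suc n) p)) =
       u ^ Suc a * v ^ Suc b +
       ((\<Sum>i=1..<a. u ^ site 2 (ins i (Suc n) p) * v ^ site 3 (ins i (Suc n) p)) +
        (\<Sum>i=a..<b. u ^ site 2 (ins i (Suc n) p) * v ^ site 3 (ins i (Suc n) p)))"
      using ab by (simp add: s2 s3 sum.union_disjoint)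
    also have "(\<Sum>i=1..<a. u ^ site 2 (ins i (Suc n) p) * v ^ site 3 (ins i (Suc n) p)) =
        (\<Sum>i=1..<a. u ^ Suc i) * v ^ Suc b"
      unfolding sum_distrib_right using ab by (intro sum.cong) (auto simp: s2 s3 min_def)
    also have "(\<Sum>i=a..<b. u ^ site 2 (ins i (Suc n) p) * v ^ site 3 (ins i (Suc n) p)) =
        u ^ a * (\<Sum>i=a..<b. v ^ Suc i)"
      unfolding sum_distrib_left using ab by (intro sum.cong) (auto simp: s2 s3 min_def)
    finally have *: "(\<Sum>i<b. u ^ site 2 (ins i (Suc n) p) * v ^ site 3 (ins i (Suc n) p)) =
       u ^ Suc a * v ^ Suc b + ((u ^ Suc a - u ^ Suc 1) / (u - 1) * v ^ Suc b +
        u ^ a * ((v ^ Suc b - v ^ Suc a) / (v - 1)))"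
      using geometric_shift[OF ab(1) assms(1)] geometric_shift[OF ab(2) assms(2)] by simp
    have "u - 1 \<noteq> 0" "v - 1 \<noteq> 0" using assms by auto
    then show ?thesis unfolding a_def[symmetric] b_def[symmetric] *
      by (simp add: divide_simps power2_eq_square power_mult_distrib) (simp add: algebra_simps)
  qed
  show ?thesis unfolding site_poly_def
    using sum_inc_avoiders_Suc[of "\<lambda>p. u ^ site 2 p * v ^ site 3 p" 3 n]
    by (simp add: step[simplified] sum_subtractf sum_distrib_left sum.distrib del: power_Suc)
qed

section \<open>Antisymmetrisation of the kernel equation\<close>

text \<open>
  With $u = (y+z)/z$ and $v = (x+y+z)/(y+z)$ the kernel in \<open>site_poly_Suc\<close> becomes the symmetric function
  $(x+y+z)(1/x+1/y+1/z)$. One of the two boundary terms is then symmetric in $y, z$, the other in $x, y$.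
\<close>

definition weyl_term :: "nat \<Rightarrow> 'a \<Rightarrow> 'a \<Rightarrow> 'a \<Rightarrow> 'a::field" where
  "weyl_term n x y z = x * site_poly n ((y + z) / z) ((x + y + z) / (y + z))"

lemma weyl_term_Suc:
  fixes x y z :: "'a::field"
  assumes "x \<noteq> 0" "y \<noteq> 0" "z \<noteq> 0" "y + z \<noteq> 0"
  shows "weyl_term (Suc n) x y z =
    (x + y + z) * (1 / x + 1 / y + 1 / z) * weyl_term n x y z
    - x * (x + y + z) * (y + z) / (y * z) * site_poly n 1 ((x + y + z) / (y + z))
    - (x + y + z) * site_poly n ((x + y + z) / z) 1"
proof -
  define u v where "u = (y + z) / z" and "v = (x + y + z) / (y + z)"
  have u1: "u - 1 = y / z" and v1: "v - 1 = x / (y + z)" 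
    using assms by (auto simp: u_def v_def field_simps)
  have uv: "u * v = (x + y + z) / z" using assms by (simp add: u_def v_def)
  have "u \<noteq> 1" "v \<noteq> 1" using u1 v1 assms by auto
  note eq = site_poly_Suc[OF this, of n]
  have "(w / z)\<^sup>2 * (s / w) / (y / z) = s * w / (y * z)" if "w \<noteq> 0" for w s
    using assms that by (simp add: field_simps power2_eq_square)
  then have c1: "u\<^sup>2 * v / (u - 1) = (x + y + z) * (y + z) / (y * z)"
    unfolding u1 unfolding u_def v_def using assms by blast
  have c2: "v / (v - 1) = (x + y + z) / x"
    unfolding v1 unfolding v_def using assms by simp
  have c3: "(x + y + z) * (y + z) / (y * z) + (x + y + z) / x = (x + y + z) * (1 / x + 1 / y + 1 / z)"
    using assms by (simp add: field_simps)
  have eq': "x * (s * r * f - s * w / m * g - s / x * h) = s * r * (x * f) - x * s * w / m * g - s * h"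
    for s r f w m g h
    using assms(1) by (simp add: right_diff_distrib mult.assoc mult.left_commute)
  show ?thesis
    unfolding weyl_term_def u_def[symmetric] v_def[symmetric] eq c1 c2 uv c3
    by (rule eq')
qed

definition weyl_sum :: "nat \<Rightarrow> 'a \<Rightarrow> 'a \<Rightarrow> 'a \<Rightarrow> 'a::field" where
  "weyl_sum n x y z = weyl_term n x y z - weyl_term n x z y - weyl_term n y x z
     + weyl_term n y z x + weyl_term n z x y - weyl_term n z y x"

text \<open>The kernel is a common factor of the six terms, so once the boundary terms cancel, each
  level multiplies the sum by the kernel.\<close>

lemma weyl_sum_eq:
  fixes x y z :: "'a::field"
  assumes nz: "x \<noteq> 0" "y \<noteq> 0" "z \<noteq> 0" "y + z \<noteq> 0" "x + z \<noteq> 0" "x + y \<noteq> 0"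
  shows "weyl_sum n x y z = (x + y + z) * ((x + y + z) * (1 / x + 1 / y + 1 / z)) ^ n
     * (x / z - x / y - y / z + y / x + z / y - z / x)"
proof (induction n)
  case 0
  have w: "weyl_term 0 a b c = s * (a / c)" if "b + c \<noteq> 0" "a + b + c = s" for a b c s :: 'a
    using that by (simp add: weyl_term_def site_poly_0)
  define s where "s = x + y + z"
  have "weyl_term 0 x y z = s * (x / z)" "weyl_term 0 x z y = s * (x / y)"
    "weyl_term 0 y x z = s * (y / z)" "weyl_term 0 y z x = s * (y / x)"
    "weyl_term 0 z x y = s * (z / y)" "weyl_term 0 z y x = s * (z / x)"
    by (rule w; use nz in \<open>simp add: s_def add_ac\<close>)+
  then show ?case unfolding weyl_sum_def s_def[symmetric] by (simp add: algebra_simps)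
next
  case (Suc n)
  define s where "s = x + y + z"
  define K where "K = s * (1 / x + 1 / y + 1 / z)"
  \<comment> \<open>With the symmetric quantities \<open>s\<close> and x y z fixed, one boundary
    term depends only on the first variable and the other only on the last. In
    \<open>weyl_sum\<close> each value of \<open>A\<close> and of \<open>B\<close> occurs once with
    either sign.\<close>
  define A where "A a = a * s * (s - a) / (x * y * z / a) * site_poly n 1 (s / (s - a))" for a
  define B where "B c = s * site_poly n (s / c) 1" for c
  have w: "weyl_term (Suc n) a b c = K * weyl_term n a b c - A a - B c"
    if "a \<noteq> 0" "b \<noteq> 0" "c \<noteq> 0" "b + c \<noteq> 0" and s: "a + b + c = s"
      and r: "1 / a + 1 / b + 1 / c = 1 / x + 1 / y + 1 / z" and m: "a * b * c = x * y * z" for a b c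
  proof -
    have "b + c = s - a" using s by (simp add: algebra_simps)
    moreover have "b * c = x * y * z / a"
      using m \<open>a \<noteq> 0\<close> by (simp add: eq_divide_eq mult.commute mult.left_commute)
    ultimately show ?thesis using weyl_term_Suc[OF that(1-4), of n]
      unfolding s r A_def B_def K_def by simp
  qed
  have eqs: "weyl_term (Suc n) x y z = K * weyl_term n x y z - A x - B z"
    "weyl_term (Suc n) x z y = K * weyl_term n x z y - A x - B y"
    "weyl_term (Suc n) y x z = K * weyl_term n y x z - A y - B z"
    "weyl_term (Suc n) y z x = K * weyl_term n y z x - A y - B x"
    "weyl_term (Suc n) z x y = K * weyl_term n z x y - A z - B y"
    "weyl_term (Suc n) z y x = K * weyl_term n z y x - A z - B x"
    by (rule w; use nz in \<open>simp add: s_def add_ac mult_ac\<close>)+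
  have "weyl_sum (Suc n) x y z = K * weyl_sum n x y z"
    unfolding weyl_sum_def eqs by (simp add: algebra_simps)
  then show ?case using Suc by (simp add: K_def s_def)
qed

section \<open>Coefficient extraction\<close>

definition one_plus :: "'a::field \<Rightarrow> 'a fps" where
  "one_plus c = 1 + fps_const c * fps_X"

text \<open>The power of 1 + c X with exponent a - b, which may be negative.\<close>

definition one_plus_quot :: "'a::field \<Rightarrow> nat \<Rightarrow> nat \<Rightarrow> 'a fps" where
  "one_plus_quot c a b = one_plus c ^ a * inverse (one_plus c ^ b)"

lemma one_plus_nth_0 [simp]: "one_plus c $ 0 = 1"
  by (simp add: one_plus_def)

lemma one_plus_compose: "one_plus (1::'a::field) oo (fps_const c * fps_X) = one_plus c"
  by (simp add: one_plus_def fps_compose_add_distrib)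

lemma one_plus_power_compose: "one_plus (1::'a::field) ^ k oo (fps_const c * fps_X) = one_plus c ^ k"
  using fps_compose_power[of "fps_const c * fps_X" "one_plus 1" k] by (simp add: one_plus_compose)

text \<open>By the substitution of c X for X, the parameter enters each coefficient as a monomial.
  For c = t this makes the extracted coefficients polynomials in t.\<close>

lemma one_plus_quot_nth: "one_plus_quot c a b $ k = c ^ k * one_plus_quot 1 a b $ k"
proof -
  have "one_plus_quot 1 a b oo (fps_const c * fps_X) = one_plus_quot c a b"
    unfolding one_plus_quot_def
    by (simp add: fps_compose_mult_distrib fps_inverse_compose one_plus_power_compose fps_power_zeroth)
  then show ?thesis using fps_nth_compose_linear[of "one_plus_quot 1 a b" c k] by simp
qed

lemma one_plus_power_nth: "(one_plus c ^ n) $ k = of_nat (n choose k) * c ^ k"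
proof (induction n arbitrary: k)
  case 0 then show ?case by (cases k) auto
next
  case (Suc n)
  have "one_plus c ^ Suc n = one_plus c ^ n + fps_const c * (fps_X * one_plus c ^ n)"
    unfolding power_Suc by (simp only: one_plus_def[of c] distrib_right mult_1_left mult.assoc)
  then have "(one_plus c ^ Suc n) $ k = (one_plus c ^ n) $ k + c * (fps_X * one_plus c ^ n) $ k"
    by simp
  then show ?case by (cases k) (simp_all add: Suc algebra_simps)
qed

lemma fls_nth_divide_X_power:
  fixes f :: "'a::field fps"
  shows "fls_nth (fps_to_fls f / fls_X ^ m) (int k) = f $ (m + k)"
proof -
  have "fps_to_fls f / fls_X ^ m = fls_shift (int m) (fps_to_fls f)"
    by (simp add: nonzero_divide_eq_eq fls_X_power_times_conv_shift)
  then show ?thesis by (simp add: nat_add_distrib add.commute)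
qed

definition site_term :: "nat \<Rightarrow> nat \<Rightarrow> 'a \<Rightarrow> 'a \<Rightarrow> 'a \<Rightarrow> 'a::field" where
  "site_term a b x y z = x * ((y + z) / z) ^ a * ((x + y + z) / (y + z)) ^ b"

lemma weyl_term_altdef:
  "weyl_term n x y z = (\<Sum>p\<in>inc_avoiders 4 n. site_term (site 2 p) (site 3 p) x y z)"
  by (simp add: weyl_term_def site_poly_def site_term_def sum_distrib_left mult.assoc)

lemma fls_one_plus: "fps_to_fls (one_plus c) = 1 + fls_const c * fls_X"
  by (simp add: one_plus_def fls_times_fps_to_fls)

lemma fls_one_plus_quot:
  "fps_to_fls (one_plus_quot c a b) = (1 + fls_const c * fls_X) ^ a / (1 + fls_const c * fls_X) ^ b"
proof -
  have "subdegree (one_plus c ^ b) = 0" by (rule subdegree_eq_0) (simp add: fps_power_zeroth)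
  from fls_inverse_fps_to_fls[OF this] show ?thesis
    unfolding one_plus_quot_def
    by (metis divide_inverse fls_one_plus fls_times_fps_to_fls fps_to_fls_power)
qed

lemma one_plus_fls_nonzero: "1 + fls_const c * fls_X \<noteq> (0 :: 'a::field fls)"
proof -
  have "one_plus c \<noteq> 0" by (metis one_plus_nth_0 fps_zero_nth zero_neq_one)
  then show ?thesis by (metis fls_one_plus fps_to_fls_eq_0_iff)
qed

text \<open>When y + z is an invertible power series, the only possible pole comes from z^a. Four of
  the six orderings are of this kind.\<close>

lemma site_term_quot:
  fixes x y z :: "real fls"
  assumes s: "x + y + z = fps_to_fls (one_plus d)" and yz: "y + z = 1 + fls_const c * fls_X"
  shows "site_term a (Suc b) x y z = fps_to_fls (one_plus d) *
    (x * fps_to_fls (one_plus d ^ b * one_plus_quot c a (Suc b)) / z ^ a)"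
  unfolding site_term_def s yz
  by (simp add: fls_times_fps_to_fls fps_to_fls_power fls_one_plus_quot power_divide mult_ac)

lemma fls_nth_1_const_X:
  fixes f :: "real fps"
  shows "fls_nth (fls_const k * fls_X * fps_to_fls f / fls_X ^ m) 1 = k * fps_nth f m"
proof -
  have "fls_const k * fls_X * fps_to_fls f = fps_to_fls (fps_const k * fps_X * f)"
    by (simp add: fls_times_fps_to_fls)
  then show ?thesis using fls_nth_divide_X_power[of "fps_const k * fps_X * f" m 1]
    by (simp add: mult.assoc)
qed

text \<open>Here y + z is a monomial: a polynomial of degree b is divided by X^(b+1), so only
  negative powers of X remain.\<close>

lemma site_term_monomial:
  fixes x y z :: "real fls"
  assumes s: "x + y + z = fps_to_fls (one_plus d)" and yz: "y + z = fls_const d * fls_X"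
    and x: "x = 1" and z: "z = fls_const e * fls_X" and "d \<noteq> 0" "e \<noteq> 0"
  shows "fls_nth (site_term a (Suc b) x y z / fps_to_fls (one_plus d)) 1 = 0"
proof -
  define P :: "real fls" where "P = fps_to_fls (one_plus d)"
  have P: "P \<noteq> 0" unfolding P_def fls_one_plus by (rule one_plus_fls_nonzero)
  define k where "k = (d / e) ^ a / d ^ Suc b"
  have "site_term a (Suc b) x y z / P =
      (fls_const d / fls_const e) ^ a * (P ^ b / (fls_const d ^ Suc b * fls_X ^ Suc b))"
    unfolding site_term_def s yz P_def[symmetric] unfolding x z using P
    by (simp add: power_divide power_mult_distrib)
  also have "\<dots> = fps_to_fls (fps_const k * one_plus d ^ b) / fls_X ^ Suc b"
    by (simp add: k_def fls_times_fps_to_fls fps_to_fls_power P_def fls_const_power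
        flip: fls_const_divide_const fls_const_mult_const)
  finally show ?thesis unfolding P_def
    using fls_nth_divide_X_power[of "fps_const k * one_plus d ^ b" "Suc b" 1]
    by (simp add: one_plus_power_nth binomial_eq_0)
qed

text \<open>
  After the substitution $x = tX$, $y = X$, $z = 1$ and division by $x + y + z$, the two terms of the
  antisymmetrised sum that contain powers of $x + y$ have only negative powers of $X$, so they drop out
  of the coefficient of $X$. A second extraction, of the coefficient of $t$, then isolates the number of permutations.
\<close>

lemma weyl_sum_coeff_left:
  fixes t :: real and n :: nat
  assumes t: "t \<noteq> 0" "t \<noteq> -1"
  defines "\<alpha> \<equiv> \<lambda>c p. fps_nth (one_plus (1 + t) ^ (site 3 p - 1) * one_plus_quot c (site 2 p) (site 3 p)) (site 2 p)"
  shows "fls_nth (weyl_sum n (fls_const t * fls_X) fls_X 1 / fps_to_fls (one_plus (1 + t))) 1 =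
    (\<Sum>p\<in>inc_avoiders 4 n. t - t * \<alpha> 1 p - 1 + \<alpha> t p / t ^ site 2 p)"
proof -
  define x y P :: "real fls" where "x = fls_const t * fls_X" and "y = fls_X"
    and "P = fps_to_fls (one_plus (1 + t))"
  have P: "P \<noteq> 0" unfolding P_def fls_one_plus by (rule one_plus_fls_nonzero)
  have Pxy: "P = x + y + 1"
    by (simp add: P_def x_def y_def fls_one_plus distrib_right flip: fls_plus_const)
  have xy: "x + y = fls_const (1 + t) * fls_X"
    by (simp add: x_def y_def distrib_right flip: fls_plus_const)
  have t1: "1 + t \<noteq> 0" using t by simp
  \<comment> \<open>If the last variable is 1, there is no pole and the coefficient is the factor of
    X. If 1 is in the middle, the pole shifts the extraction to index \<open>site 2 p\<close>. If 1
    comes first, the degree argument gives 0.\<close>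
  have eq: "fls_nth (site_term (site 2 p) (site 3 p) x y 1 / P) 1 = t"
    "fls_nth (site_term (site 2 p) (site 3 p) x 1 y / P) 1 = t * \<alpha> 1 p"
    "fls_nth (site_term (site 2 p) (site 3 p) y x 1 / P) 1 = 1"
    "fls_nth (site_term (site 2 p) (site 3 p) y 1 x / P) 1 = \<alpha> t p / t ^ site 2 p"
    "fls_nth (site_term (site 2 p) (site 3 p) 1 x y / P) 1 = 0"
    "fls_nth (site_term (site 2 p) (site 3 p) 1 y x / P) 1 = 0" for p
  proof -
    obtain b where b: "site 3 p = Suc b" using site_pos[of 3 p] by (cases "site 3 p") auto
    define a where "a = site 2 p"
    define f where "f c = one_plus (1 + t) ^ b * one_plus_quot c a (Suc b)" for c
    have C: "P * u / P = u" for u using P by simp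
    have f: "\<alpha> c p = fps_nth (f c) a" for c by (simp add: \<alpha>_def f_def a_def b)
    have f0: "fps_nth (f c) 0 = 1" for c by (simp add: f_def one_plus_quot_def fps_power_zeroth)
    have s: "x + y + 1 = fps_to_fls (one_plus (1 + t))" "x + 1 + y = fps_to_fls (one_plus (1 + t))"
      "y + x + 1 = fps_to_fls (one_plus (1 + t))" "y + 1 + x = fps_to_fls (one_plus (1 + t))"
      by (simp_all add: Pxy[unfolded P_def] add_ac)
    have c: "y + 1 = 1 + fls_const 1 * fls_X" "1 + y = 1 + fls_const 1 * fls_X"
      "x + 1 = 1 + fls_const t * fls_X" "1 + x = 1 + fls_const t * fls_X"
      by (simp_all add: x_def y_def add.commute)
    have "site_term a (Suc b) x y 1 = P * (x * fps_to_fls (f 1) / 1 ^ a)"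
      unfolding P_def f_def by (rule site_term_quot[OF s(1) c(1)])
    also have "x * fps_to_fls (f 1) / 1 ^ a = fls_const t * fls_X * fps_to_fls (f 1) / fls_X ^ 0"
      by (simp add: x_def)
    finally show "fls_nth (site_term (site 2 p) (site 3 p) x y 1 / P) 1 = t"
      unfolding b a_def[symmetric] by (simp only: C fls_nth_1_const_X f0 mult_1_right)
    have "site_term a (Suc b) x 1 y = P * (x * fps_to_fls (f 1) / y ^ a)"
      unfolding P_def f_def by (rule site_term_quot[OF s(2) c(2)])
    then show "fls_nth (site_term (site 2 p) (site 3 p) x 1 y / P) 1 = t * \<alpha> 1 p"
      unfolding b f a_def[symmetric] x_def y_def by (simp only: C fls_nth_1_const_X)
    have "site_term a (Suc b) y x 1 = P * (y * fps_to_fls (f t) / 1 ^ a)"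
      unfolding P_def f_def by (rule site_term_quot[OF s(3) c(3)])
    also have "y * fps_to_fls (f t) / 1 ^ a = fls_const 1 * fls_X * fps_to_fls (f t) / fls_X ^ 0"
      by (simp add: y_def)
    finally show "fls_nth (site_term (site 2 p) (site 3 p) y x 1 / P) 1 = 1"
      unfolding b a_def[symmetric] by (simp only: C fls_nth_1_const_X f0 mult_1_right)
    have "site_term a (Suc b) y 1 x = P * (y * fps_to_fls (f t) / x ^ a)"
      unfolding P_def f_def by (rule site_term_quot[OF s(4) c(4)])
    also have "y * fps_to_fls (f t) / x ^ a = fls_const (1 / t ^ a) * fls_X * fps_to_fls (f t) / fls_X ^ a"
      unfolding x_def y_def power_mult_distrib fls_const_divide_const[symmetric] fls_const_power
      by (simp only: fls_const_1 divide_divide_eq_left times_divide_eq_left mult_1_left)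
    finally show "fls_nth (site_term (site 2 p) (site 3 p) y 1 x / P) 1 = \<alpha> t p / t ^ site 2 p"
      unfolding b f a_def[symmetric] by (simp only: C fls_nth_1_const_X) simp
    show "fls_nth (site_term (site 2 p) (site 3 p) 1 x y / P) 1 = 0" unfolding b P_def
      by (rule site_term_monomial[where e = 1]) (use t1 in \<open>simp_all add: Pxy[unfolded P_def] xy add_ac\<close>, simp_all add: y_def)
    show "fls_nth (site_term (site 2 p) (site 3 p) 1 y x / P) 1 = 0" unfolding b P_def
      by (rule site_term_monomial[where e = t]) (use t1 t in \<open>simp_all add: Pxy[unfolded P_def] xy add_ac\<close>, simp_all add: x_def)
  qed
  have w: "weyl_term n u v w / P = (\<Sum>p\<in>inc_avoiders 4 n. site_term (site 2 p) (site 3 p) u v w / P)" for u v w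
    by (simp add: weyl_term_altdef sum_divide_distrib)
  have "weyl_sum n x y 1 / P = (\<Sum>p\<in>inc_avoiders 4 n.
      site_term (site 2 p) (site 3 p) x y 1 / P - site_term (site 2 p) (site 3 p) x 1 y / P
      - site_term (site 2 p) (site 3 p) y x 1 / P + site_term (site 2 p) (site 3 p) y 1 x / P
      + site_term (site 2 p) (site 3 p) 1 x y / P - site_term (site 2 p) (site 3 p) 1 y x / P)"
    unfolding weyl_sum_def add_divide_distrib diff_divide_distrib w sum_subtractf sum.distrib ..
  then have "fls_nth (weyl_sum n x y 1 / P) 1 = (\<Sum>p\<in>inc_avoiders 4 n. t - t * \<alpha> 1 p - 1 + \<alpha> t p / t ^ site 2 p)"
    by (simp add: fls_nth_sum eq)
  then show ?thesis unfolding x_def y_def P_def .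
qed

lemma one_plus_product_nth:
  fixes s d :: real
  assumes s: "s \<noteq> 0"
  shows "fps_nth ((one_plus d * (fps_const s + fps_X)) ^ n) (n + k) =
    (\<Sum>i\<le>n. of_nat (n choose (i + k)) * of_nat (n choose i) * d ^ (i + k) * s ^ i)"
proof -
  have "fps_const s + fps_X = fps_const s * one_plus (1 / s)"
    using s by (simp add: one_plus_def distrib_left flip: mult.assoc)
  then have "(fps_const s + fps_X) ^ n = fps_const (s ^ n) * one_plus (1 / s) ^ n"
    by (simp add: power_mult_distrib)
  then have nth: "fps_nth ((fps_const s + fps_X) ^ n) q = s ^ n * of_nat (n choose q) / s ^ q" for q
    by (simp add: one_plus_power_nth power_one_over)
  have "fps_nth ((one_plus d * (fps_const s + fps_X)) ^ n) (n + k) =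
     (\<Sum>l=0..n+k. of_nat (n choose l) * d ^ l * (s ^ n * of_nat (n choose (n + k - l)) / s ^ (n + k - l)))"
    unfolding power_mult_distrib fps_mult_nth by (simp add: nth one_plus_power_nth)
  \<comment> \<open>For l < k the second binomial coefficient has lower index above n and vanishes,
    so l = i + k may be substituted.\<close>
  also have "\<dots> = (\<Sum>l=0+k..n+k. of_nat (n choose l) * d ^ l * (s ^ n * of_nat (n choose (n + k - l)) / s ^ (n + k - l)))"
    by (rule sum.mono_neutral_right) auto
  also have "\<dots> = (\<Sum>i=0..n. of_nat (n choose (i + k)) * d ^ (i + k) * (s ^ n * of_nat (n choose (n - i)) / s ^ (n - i)))"
    unfolding sum.shift_bounds_cl_nat_ivl by simp
  also have "\<dots> = (\<Sum>i\<le>n. of_nat (n choose (i + k)) * of_nat (n choose i) * d ^ (i + k) * s ^ i)"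
    unfolding atLeast0AtMost
  proof (rule sum.cong[OF refl])
    fix i assume "i \<in> {..n}"
    then have i: "i \<le> n" by simp
    then have "s ^ n / s ^ (n - i) = s ^ i" using s by (simp add: power_diff)
    then have "s ^ n = s ^ i * s ^ (n - i)" using i by (simp flip: power_add)
    then show "of_nat (n choose (i + k)) * d ^ (i + k) * (s ^ n * of_nat (n choose (n - i)) / s ^ (n - i)) =
        of_nat (n choose (i + k)) * of_nat (n choose i) * d ^ (i + k) * s ^ i"
      using s binomial_symmetric[OF i] by simp
  qed
  finally show ?thesis .
qed

text \<open>Kernel and antisymmetric factor are \<open>G / X\<close> and \<open>D / X\<close>, so
  the coefficient of X is that of X^(n+2) in D G^n. The three powers of X in \<open>D\<close> shift
  this index to n, n + 1 and n + 2.\<close>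

lemma weyl_sum_coeff_right:
  fixes t :: real and n :: nat
  assumes t: "t \<noteq> 0" "t \<noteq> -1"
  defines "\<kappa> \<equiv> \<lambda>k. \<Sum>i\<le>n. of_nat (n choose (i + k)) * of_nat (n choose i) * (1 + t) ^ (i + k) * (1 + 1 / t) ^ i"
  shows "fls_nth (weyl_sum n (fls_const t * fls_X) fls_X 1 / fps_to_fls (one_plus (1 + t))) 1 =
    (t - 1) * \<kappa> 0 + (1 / t - t) * \<kappa> 1 + (1 - 1 / t) * \<kappa> 2"
proof -
  define x y P :: "real fls" where "x = fls_const t * fls_X" and "y = fls_X"
    and "P = fps_to_fls (one_plus (1 + t))"
  define G where "G = one_plus (1 + t) * (fps_const (1 + 1 / t) + fps_X)"
  define D where "D = fps_const (t - 1) * fps_X ^ 2 + fps_const (1 / t - t) * fps_X ^ 1 + fps_const (1 - 1 / t)"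
  have P: "P \<noteq> 0" unfolding P_def fls_one_plus by (rule one_plus_fls_nonzero)
  have Pxy: "x + y + 1 = P"
    by (simp add: P_def x_def y_def fls_one_plus distrib_right flip: fls_plus_const)
  have xy: "x + y = fls_const (1 + t) * fls_X"
    by (simp add: x_def y_def distrib_right flip: fls_plus_const)
  have nz: "x \<noteq> 0" "y \<noteq> 0" "x + y \<noteq> 0" "y + 1 \<noteq> 0" "x + 1 \<noteq> 0"
  proof -
    show "x \<noteq> 0" "y \<noteq> 0" "x + y \<noteq> 0" unfolding xy using t by (auto simp: x_def y_def)
    show "y + 1 \<noteq> 0" "x + 1 \<noteq> 0"
      using one_plus_fls_nonzero[of "1::real"] one_plus_fls_nonzero[of t] by (auto simp: x_def y_def add.commute)
  qed
  have f1: "1 / (c * X) + 1 / X + 1 = (1 + 1 / c + X) / X"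
    and f2: "c * X - c * X / X - X + X / (c * X) + 1 / X - 1 / (c * X) =
      ((c - 1) * X\<^sup>2 + (1 / c - c) * X + (1 - 1 / c)) / X"
    if "c \<noteq> 0" "X \<noteq> 0" for c X :: "real fls"
    using that by (simp_all add: divide_simps power2_eq_square) (simp_all add: algebra_simps)
  have c: "fls_const t \<noteq> 0" "fls_X \<noteq> (0::real fls)" using t by auto
  have G: "P * (1 / x + 1 / y + 1) = fps_to_fls G / fls_X"
    unfolding x_def y_def P_def f1[OF c] G_def fls_times_fps_to_fls fps_to_fls_plus fps_const_to_fls fps_X_to_fls
      fls_plus_const[symmetric] fls_const_divide_const[symmetric] fls_const_1 by (simp only: times_divide_eq_right)
  have D: "x - x / y - y + y / x + 1 / y - 1 / x = fps_to_fls D / fls_X"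
    unfolding x_def y_def f2[OF c] D_def fls_times_fps_to_fls fps_to_fls_plus fps_const_to_fls fps_X_to_fls
      fls_plus_const[symmetric] fls_minus_const[symmetric] fls_const_divide_const[symmetric] fls_const_1 fps_to_fls_power
    by (simp only: power_one_right)
  have "weyl_sum n x y 1 / P = (fps_to_fls G / fls_X) ^ n * (fps_to_fls D / fls_X)"
    unfolding weyl_sum_eq[OF nz(1,2) one_neq_zero nz(4,5,3)] Pxy div_by_1 G D using P by simp
  also have "\<dots> = fps_to_fls (D * G ^ n) / fls_X ^ (n + 1)"
    unfolding power_divide fls_times_fps_to_fls fps_to_fls_power power_add power_one_right
    by (simp only: times_divide_times_eq mult.commute)
  finally have "fls_nth (weyl_sum n x y 1 / P) 1 = fps_nth (D * G ^ n) (n + 2)"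
    using fls_nth_divide_X_power[of "D * G ^ n" "n + 1" 1] by simp
  also have "\<dots> = (t - 1) * fps_nth (G ^ n) (n + 0) + (1 / t - t) * fps_nth (G ^ n) (n + 1)
      + (1 - 1 / t) * fps_nth (G ^ n) (n + 2)"
    unfolding D_def distrib_right mult.assoc by (simp add: fps_X_power_mult_nth)
  also have "\<dots> = (t - 1) * \<kappa> 0 + (1 / t - t) * \<kappa> 1 + (1 - 1 / t) * \<kappa> 2"
  proof -
    have "1 + 1 / t \<noteq> 0" using t by (simp add: field_simps)
    from one_plus_product_nth[OF this, of "1 + t" n] show ?thesis by (simp only: G_def \<kappa>_def)
  qed
  finally show ?thesis unfolding x_def y_def P_def .
qed

lemma coeff_one_plus_X_power: "coeff ([:1, 1:] ^ n :: 'a::comm_semiring_1 poly) k = of_nat (n choose k)"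
proof (cases "k \<le> n")
  case False
  have "degree ([:1, 1:] ^ n :: 'a poly) \<le> 1 * n"
    by (rule order.trans[OF degree_power_le]) simp
  then show ?thesis using False by (simp add: coeff_eq_0 binomial_eq_0)
qed (simp add: coeff_linear_poly_power)

text \<open>
  As polynomials in \<open>t\<close>, these are the two families of coefficients on the right-hand side
  of \<open>weyl_sum_coeff_left\<close>: \<open>e\<close> selects whether the quotient is formed with \<open>t\<close> or with 1.
\<close>

definition one_plus_poly :: "nat \<Rightarrow> nat \<Rightarrow> bool \<Rightarrow> real poly" where
  "one_plus_poly a b e = (\<Sum>m\<le>a. smult (of_nat (b choose m) * fps_nth (one_plus_quot 1 a (Suc b)) (a - m))
     ([:1, 1:] ^ m * (if e then monom 1 (a - m) else 1)))"

lemma poly_one_plus_poly: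
  "poly (one_plus_poly a b e) t =
     fps_nth (one_plus (1 + t) ^ b * one_plus_quot (if e then t else 1) a (Suc b)) a"
  unfolding one_plus_poly_def fps_mult_nth poly_sum atLeast0AtMost
  by (rule sum.cong[OF refl], subst one_plus_quot_nth[of "if e then t else 1"]) (simp add: one_plus_power_nth poly_monom mult_ac)

text \<open>At t = 0 all factors are powers of 1 + X, and the product collapses to the power a - 1,
  whose coefficient at a is 0.\<close>

lemma poly_one_plus_poly_0:
  assumes "a > 0" shows "poly (one_plus_poly a b False) 0 = 0"
proof -
  obtain a' where a: "a = Suc a'" using assms by (cases a) auto
  have nz: "fps_nth (one_plus (1::real) ^ k) 0 \<noteq> 0" for k by (simp add: fps_power_zeroth)
  have "one_plus (1::real) ^ b * one_plus_quot 1 a (Suc b) =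
      one_plus 1 ^ a' * (one_plus 1 ^ Suc b * inverse (one_plus 1 ^ Suc b))"
    by (simp add: one_plus_quot_def a mult_ac)
  also have "\<dots> = one_plus 1 ^ a'" using inverse_mult_eq_1'[OF nz] by (simp only: mult_1_right)
  finally show ?thesis unfolding poly_one_plus_poly by (simp add: one_plus_power_nth a)
qed

text \<open>Each summand has degree at most m + (a - m). Together with the vanishing at t = 0, this
  leaves a single term t per permutation when the coefficient of t is taken.\<close>

lemma coeff_one_plus_poly_above: "coeff (one_plus_poly a b True) (Suc a) = 0"
proof -
  have "degree ([:1, 1:] ^ m * monom (1::real) (a - m)) \<le> a" if "m \<le> a" for m
  proof -
    have "degree ([:1, 1:] ^ m * monom (1::real) (a - m)) \<le> degree ([:1, 1:] ^ m :: real poly) + (a - m)"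
      using degree_mult_le[of "[:1, 1:] ^ m" "monom (1::real) (a - m)"] by (simp add: degree_monom_eq)
    also have "degree ([:1, 1:] ^ m :: real poly) \<le> 1 * m"
      by (rule order.trans[OF degree_power_le]) simp
    finally show ?thesis using that by simp
  qed
  then show ?thesis unfolding one_plus_poly_def coeff_sum
    by (intro sum.neutral ballI) (auto simp: coeff_eq_0 less_Suc_eq_le)
qed

text \<open>The two evaluations of the coefficient of X agree for all real t except 0 and -1, hence
  as polynomials. In the coefficient of t each permutation contributes 1.\<close>

lemma card_inc_avoiders_binomial:
  "real (card (inc_avoiders 4 n)) = (\<Sum>i\<le>n.
     of_nat (n choose i) ^ 2 * (of_nat (2 * i choose i) - of_nat (2 * i choose Suc i)) +
     of_nat (n choose i) * of_nat (n choose Suc i) *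
       (of_nat (2 * i + 1 choose (i + 2)) - of_nat (2 * i + 1 choose i)) +
     of_nat (n choose i) * of_nat (n choose (i + 2)) *
       (of_nat (2 * i + 2 choose (i + 1)) - of_nat (2 * i + 2 choose (i + 2))))"
    (is "_ = sum ?r _")
proof -
  define a b where "a = site 2" and "b p = site 3 p - 1" for p
  define A B where "A p = one_plus_poly (a p) (b p) False" and "B p = one_plus_poly (a p) (b p) True" for p
  \<comment> \<open>Both sides are multiplied by t^(n+1), which clears the negative powers of t
    because \<open>site 2 p\<close> is at most n + 1. The coefficient of t thereby becomes that of
    t^(n+2).\<close>
  define l where "l = (\<Sum>p\<in>inc_avoiders 4 n. monom 1 (n + 2) - monom 1 (n + 2) * A p
      - monom 1 (n + 1) + monom 1 (n + 1 - a p) * B p)"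
  define r where "r = (\<Sum>i\<le>n.
      smult (of_nat (n choose i) ^ 2) ([:-1, 1:] * [:1, 1:] ^ (2 * i) * monom 1 (n + 1 - i)) +
      smult (of_nat (n choose i) * of_nat (n choose Suc i)) ([:1, 0, -1:] * [:1, 1:] ^ (2 * i + 1) * monom 1 (n - i)) +
      smult (of_nat (n choose i) * of_nat (n choose (i + 2))) ([:-1, 1:] * [:1, 1:] ^ (2 * i + 2) * monom (1::real) (n - i)))"
  have ab: "0 < a p" "site 3 p = Suc (b p)" "a p \<le> Suc n" if "p \<in> inc_avoiders 4 n" for p
    using site_pos[of 2 p] site_pos[of 3 p] site_le[of 2 p] inc_avoidersD(3)[OF that] by (auto simp: a_def b_def)
  have "poly l t = poly r t" if t: "t \<noteq> 0" "t \<noteq> -1" for t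
  proof -
    define s where "s = 1 + 1 / t"
    have s: "s = (1 + t) / t" using t by (simp add: s_def field_simps)
    have "poly l t = (\<Sum>p\<in>inc_avoiders 4 n. t ^ (n + 1) * (t - t * poly (A p) t - 1 + poly (B p) t / t ^ a p))"
      unfolding l_def poly_sum
    proof (rule sum.cong[OF refl])
      fix p assume "p \<in> inc_avoiders 4 n"
      then have "t ^ (n + 1 - a p) = t ^ (n + 1) / t ^ a p" using ab(3)[of p] t by (simp add: power_diff)
      then show "poly (monom 1 (n + 2) - monom 1 (n + 2) * A p - monom 1 (n + 1) + monom 1 (n + 1 - a p) * B p) t =
         t ^ (n + 1) * (t - t * poly (A p) t - 1 + poly (B p) t / t ^ a p)"
        by (simp add: poly_monom) (simp add: algebra_simps)
    qed
    also have "\<dots> = t ^ (n + 1) * fls_nth (weyl_sum n (fls_const t * fls_X) fls_X 1 / fps_to_fls (one_plus (1 + t))) 1"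
      unfolding weyl_sum_coeff_left[OF t] sum_distrib_left
      by (rule sum.cong[OF refl]) (simp add: A_def B_def poly_one_plus_poly ab a_def[symmetric])
    also have "\<dots> = poly r t"
      unfolding weyl_sum_coeff_right[OF t] s_def[symmetric] r_def poly_sum sum_distrib_left distrib_left sum.distrib[symmetric]
    proof (rule sum.cong[OF refl])
      fix i assume "i \<in> {..n}"
      then have i: "i \<le> n" by simp
      define T where "T = t ^ (n - i)"
      have T: "t ^ (n + 1) = T * t ^ i * t" "t ^ (n + 1 - i) = T * t"
        using i by (simp_all add: T_def Suc_diff_le flip: power_add)
      have si: "t ^ i * s ^ i = (1 + t) ^ i" unfolding s power_divide using t by simp
      show "t ^ (n + 1) * ((t - 1) * (real (n choose (i + 0)) * real (n choose i) * (1 + t) ^ (i + 0) * s ^ i)) +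
         t ^ (n + 1) * ((1 / t - t) * (real (n choose (i + 1)) * real (n choose i) * (1 + t) ^ (i + 1) * s ^ i)) +
         t ^ (n + 1) * ((1 - 1 / t) * (real (n choose (i + 2)) * real (n choose i) * (1 + t) ^ (i + 2) * s ^ i)) =
         poly (smult (of_nat (n choose i) ^ 2) ([:-1, 1:] * [:1, 1:] ^ (2 * i) * monom 1 (n + 1 - i)) +
      smult (of_nat (n choose i) * of_nat (n choose Suc i)) ([:1, 0, -1:] * [:1, 1:] ^ (2 * i + 1) * monom 1 (n - i)) +
      smult (of_nat (n choose i) * of_nat (n choose (i + 2))) ([:-1, 1:] * [:1, 1:] ^ (2 * i + 2) * monom (1::real) (n - i))) t"
        (is "?x1 + ?x2 + ?x3 = _")
      proof -
        define w where "w = (1 + t) ^ i"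
        have w2: "(1 + t) ^ (2 * i) = w * w" by (simp add: w_def mult_2 power_add)
        have x1: "?x1 = real (n choose i) ^ 2 * ((t - 1) * (w * (t ^ i * s ^ i)) * (T * t))"
          unfolding T by (simp add: w_def power2_eq_square mult_ac)
        have x2: "?x2 = real (n choose i) * real (n choose Suc i) * ((t * (1 / t - t)) * ((1 + t) * w * (t ^ i * s ^ i)) * T)"
          unfolding T by (simp add: w_def mult_ac)
        have x3: "?x3 = real (n choose i) * real (n choose (i + 2)) * ((t * (1 - 1 / t)) * ((1 + t) ^ 2 * w * (t ^ i * s ^ i)) * T)"
          unfolding T by (simp add: w_def power_add power2_eq_square mult_ac)
        have t2: "t * (1 / t - t) = 1 - t * t" and t3: "t * (1 - 1 / t) = t - 1" using t by (simp_all add: field_simps)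
        have "?x1 + ?x2 + ?x3 = real (n choose i) ^ 2 * ((t - 1) * (w * w) * (T * t)) +
          real (n choose i) * real (n choose Suc i) * ((1 - t * t) * ((1 + t) * w * w) * T) +
          real (n choose i) * real (n choose (i + 2)) * ((t - 1) * ((1 + t) ^ 2 * w * w) * T)"
          unfolding x1 x2 x3 t2 t3 si w_def[symmetric] ..
        moreover have pl: "poly [:-1, 1:] t = t - 1" "poly [:1, 0, -1:] t = 1 - t * t" "poly [:1, 1:] t = 1 + t"
          by simp_all
        ultimately show ?thesis
          unfolding poly_add poly_smult poly_mult poly_power poly_monom T(2) T_def[symmetric] power_add pl w2
          by (simp only: power_one_right mult_1_left mult_ac)
      qed
    qed
    finally show ?thesis .
  qed
  then have "UNIV - {0, -1} \<subseteq> {t. poly (l - r) t = 0}" by auto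
  moreover have "infinite (UNIV - {0, -1 :: real})" by (intro Diff_infinite_finite) (auto simp: infinite_UNIV_char_0)
  ultimately have "l = r" using poly_roots_finite[of "l - r"] finite_subset by fastforce
  have "coeff l (n + 2) = (\<Sum>p\<in>inc_avoiders 4 n. 1)"
    unfolding l_def coeff_sum
  proof (rule sum.cong[OF refl])
    fix p assume p: "p \<in> inc_avoiders 4 n"
    have "coeff (monom 1 (n + 2) * A p) (n + 2) = 0"
      using poly_one_plus_poly_0[OF ab(1)[OF p], of "b p"]
      by (simp add: coeff_monom_mult A_def poly_0_coeff_0)
    moreover have "coeff (monom 1 (n + 1 - a p) * B p) (n + 2) = 0"
      using ab(3)[OF p] coeff_one_plus_poly_above[of "a p" "b p"]
      by (simp add: coeff_monom_mult B_def Suc_diff_le)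
    ultimately show "coeff (monom 1 (n + 2) - monom 1 (n + 2) * A p - monom 1 (n + 1) + monom 1 (n + 1 - a p) * B p) (n + 2) = 1"
      by simp
  qed
  also have "\<dots> = real (card (inc_avoiders 4 n))" by simp
  also have "coeff l (n + 2) = sum ?r {..n}"
    unfolding \<open>l = r\<close> r_def coeff_sum
  proof (rule sum.cong[OF refl])
    fix i assume "i \<in> {..n}"
    then have i: "i \<le> n" by simp
    have c1: "coeff (f * monom 1 (n + 1 - i)) (n + 2) = coeff f (Suc i)" for f :: "real poly"
      using i by (subst mult.commute) (simp add: coeff_monom_mult)
    have c2: "coeff (f * monom 1 (n - i)) (n + 2) = coeff f (Suc (Suc i))" for f :: "real poly"
      using i by (subst mult.commute) (simp add: coeff_monom_mult)
    show "coeff (smult (of_nat (n choose i) ^ 2) ([:-1, 1:] * [:1, 1:] ^ (2 * i) * monom 1 (n + 1 - i)) +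
      smult (of_nat (n choose i) * of_nat (n choose Suc i)) ([:1, 0, -1:] * [:1, 1:] ^ (2 * i + 1) * monom 1 (n - i)) +
      smult (of_nat (n choose i) * of_nat (n choose (i + 2))) ([:-1, 1:] * [:1, 1:] ^ (2 * i + 2) * monom (1::real) (n - i))) (n + 2) = ?r i"
      unfolding coeff_add coeff_smult c1 c2
      by (simp only: mult_pCons_left coeff_add coeff_smult coeff_pCons_Suc coeff_one_plus_X_power smult_0_left mult_zero_left)
         simp
  qed
  finally show ?thesis ..
qed

section \<open>A recurrence and the growth of the number of 1234-avoiding permutations\<close>

lemma real_binomial_Suc_right: "real (n choose Suc k) = real (n choose k) * (real n - real k) / (real k + 1)"
proof (cases "k \<le> n")
  case True
  have "Suc k * (n choose Suc k) = (n - k) * (n choose k)"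
    using binomial_absorption[of k n] binomial_absorb_comp[of n k] by simp
  then have "real (Suc k) * real (n choose Suc k) = real (n - k) * real (n choose k)"
    by (metis of_nat_mult)
  then show ?thesis using True by (simp add: field_simps of_nat_diff)
qed (simp add: binomial_eq_0)

lemma real_binomial_Suc_left: "real (n choose k) = real (Suc n choose k) * (real n + 1 - real k) / (real n + 1)"
proof (cases "k \<le> Suc n")
  case True
  have "(Suc n - k) * (Suc n choose k) = Suc n * (n choose k)"
    using binomial_absorb_comp[of "Suc n" k] by simp
  then have "real (Suc n - k) * real (Suc n choose k) = real (Suc n) * real (n choose k)"
    by (metis of_nat_mult)
  then show ?thesis using True by (simp add: field_simps of_nat_diff)
qed (simp add: binomial_eq_0)

lemma real_binomial_Suc_Suc: "real (n choose k) = real (Suc n choose Suc k) * (real k + 1) / (real n + 1)"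
proof -
  have "real (Suc n) * real (n choose k) = real (Suc n choose Suc k) * real (Suc k)"
    by (metis Suc_times_binomial_eq of_nat_mult)
  then show ?thesis by (simp add: field_simps)
qed

lemma central_binomial_Suc:
  "real (2 * i + 1 choose i) = real (2 * Suc i choose Suc i) / 2"
  "real (2 * Suc i choose Suc i) = real (2 * i choose i) * 2 * (2 * real i + 1) / (real i + 1)"
proof -
  show 1: "real (2 * i + 1 choose i) = real (2 * Suc i choose Suc i) / 2"
  proof -
    have e: "Suc (2 * i + 1) = 2 * Suc i" "real (2 * i + 1) + 1 = 2 * (real i + 1)" "real i + 1 \<noteq> 0" by simp_all
    show ?thesis using real_binomial_Suc_Suc[of "2 * i + 1" i]
      unfolding e(1,2) mult_divide_mult_cancel_right[OF e(3)] .
  qed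
  have "real (2 * i choose i) = real (2 * i + 1 choose i) * (real i + 1) / (2 * real i + 1)"
    using real_binomial_Suc_left[of "2 * i" i] by (simp del: binomial_Suc_Suc add: add.commute)
  then show "real (2 * Suc i choose Suc i) = real (2 * i choose i) * 2 * (2 * real i + 1) / (real i + 1)"
    unfolding 1 by (simp add: field_simps del: mult_Suc_right)
qed

definition catalan :: "nat \<Rightarrow> real" where
  "catalan i = real (2 * i choose i) / (real i + 1)"

lemma catalan_diff:
  "real (2 * i choose i) - real (2 * i choose Suc i) = catalan i"
  "real (2 * i + 1 choose (i + 2)) - real (2 * i + 1 choose i) = - catalan (Suc i)"
proof -
  show "real (2 * i choose i) - real (2 * i choose Suc i) = catalan i"
    unfolding catalan_def real_binomial_Suc_right by (simp add: field_simps)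
  have "real (2 * i + 1 choose (i + 2)) = real (2 * i + 1 choose i) * real i / (real i + 2)"
  proof -
    have e: "real (2 * i + 1) - real i = real i + 1" "real (2 * i + 1) - real (Suc i) = real i"
      "real (Suc i) + 1 = real i + 2" "Suc (Suc i) = i + 2" "real i + 1 \<noteq> 0" by simp_all
    have "real (2 * i + 1 choose Suc i) = real (2 * i + 1 choose i)"
      using real_binomial_Suc_right[of "2 * i + 1" i] e(5) unfolding e(1) by (simp del: binomial_Suc_Suc)
    then show ?thesis using real_binomial_Suc_right[of "2 * i + 1" "Suc i"] unfolding e(2-4) by (simp only:)
  qed
  then show "real (2 * i + 1 choose (i + 2)) - real (2 * i + 1 choose i) = - catalan (Suc i)"
    unfolding catalan_def central_binomial_Suc(1)
    by (simp add: field_simps del: mult_Suc_right binomial_Suc_Suc)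
qed

text \<open>
  The summand $C_j ({n \choose j}^2 - {n \choose j}{n \choose j-1} + {n \choose j-1}{n \choose j+1})$,
  written over ${n+1 \choose j}^2$ so that it vanishes for $j > n$ without case distinctions.
\<close>

definition avoider_term :: "nat \<Rightarrow> nat \<Rightarrow> real" where
  "avoider_term n j = real (2 * j choose j) * real (Suc n choose j) ^ 2 * (real n + 1 - real j) *
     (real n + 1 + 2 * real n * real j - real j - 3 * real j ^ 2) / ((real n + 1) ^ 2 * (real j + 1) ^ 2)"

text \<open>The summand vanishes beyond n, so the upper limit is left free; the recurrence needs
  four consecutive values of n summed over one range.\<close>

lemma card_inc_avoiders_catalan:
  assumes "n < m"
  shows "real (card (inc_avoiders 4 n)) = (\<Sum>j\<le>m. avoider_term n j)"
proof -
  \<comment> \<open>The value at 0 stands for the lower index -1; truncated subtraction would give 1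
    instead of 0.\<close>
  define p where "p j = (if j = 0 then 0 else real (n choose (j - 1)))" for j
  define g where "g j = catalan j * (p j * real (n choose Suc j) - p j * real (n choose j))" for j
  have "real (card (inc_avoiders 4 n)) = (\<Sum>i\<le>n. catalan i * real (n choose i) ^ 2 + g (Suc i))"
    unfolding card_inc_avoiders_binomial
  proof (rule sum.cong[OF refl])
    fix i
    have "real (2 * i + 2 choose (i + 1)) - real (2 * i + 2 choose (i + 2)) = catalan (Suc i)"
      using catalan_diff(1)[of "Suc i"] by (simp del: binomial_Suc_Suc)
    then show "real (n choose i) ^ 2 * (real (2 * i choose i) - real (2 * i choose Suc i)) +
       real (n choose i) * real (n choose Suc i) * (real (2 * i + 1 choose (i + 2)) - real (2 * i + 1 choose i)) +
       real (n choose i) * real (n choose (i + 2)) * (real (2 * i + 2 choose (i + 1)) - real (2 * i + 2 choose (i + 2))) =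
       catalan i * real (n choose i) ^ 2 + g (Suc i)"
      unfolding catalan_diff g_def by (simp add: p_def algebra_simps)
  qed
  also have "\<dots> = (\<Sum>j\<le>Suc n. catalan j * real (n choose j) ^ 2) + (\<Sum>j\<le>Suc n. g j)"
    unfolding sum.atMost_Suc_shift[of g] by (simp add: sum.distrib g_def p_def)
  also have "\<dots> = (\<Sum>j\<le>Suc n. avoider_term n j)"
    unfolding sum.distrib[symmetric]
  proof (rule sum.cong[OF refl])
    fix j
    have pj: "p j = real (Suc n choose j) * real j / (real n + 1)"
      using real_binomial_Suc_Suc[of n "j - 1"] by (cases j) (simp_all add: p_def add.commute del: binomial_Suc_Suc)
    have nz: "real n + 1 \<noteq> 0" "real j + 1 \<noteq> 0" by linarith+
    define N J C B where "N = real n" and "J = real j" and "C = real (2 * j choose j)" and "B = real (Suc n choose j)"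
    show "catalan j * real (n choose j) ^ 2 + g j = avoider_term n j"
      unfolding g_def real_binomial_Suc_right[of n j] real_binomial_Suc_left[of n j] pj catalan_def avoider_term_def
      unfolding N_def[symmetric] J_def[symmetric] C_def[symmetric] B_def[symmetric]
      using nz[folded N_def J_def]
      by (simp add: divide_simps power2_eq_square) (simp add: algebra_simps)
  qed
  also have "\<dots> = (\<Sum>j\<le>m. avoider_term n j)"
    using assms by (intro sum.mono_neutral_left) (auto simp: avoider_term_def binomial_eq_0)
  finally show ?thesis .
qed

text \<open>
  The rational certificate of Zeilberger's algorithm. The summand itself has no telescoper of order 2;
  the one of order 3 is a left multiple of the recurrence of order 2, which is why it only yields
  the first-order equation \<open>recurrence_defect_Suc\<close> for the defect of the latter.
\<close>

lemma recurrence_certificate: 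
  fixes n j :: real
  defines "L \<equiv> n + 4 - j"
  defines "r \<equiv> \<lambda>N. N + 1 + 2 * N * j - j - 3 * j^2"
  defines "q \<equiv> \<lambda>j. 9*j^5-(144+45*n)*j^4+(829+516*n+80*n^2)*j^3-(1938+1823*n+574*n^2+60*n^3)*j^2
     +(1164+1588*n+828*n^2+190*n^3+16*n^4)*j+(944+1204*n+554*n^2+110*n^3+8*n^4)"
  shows "(n+2)*(n+3)^2*(n+4)*(n+5)^2*L*r(n+3)
     -((n+2)*(n+4)*(10*n^2+62*n+93)+(n+2)^2*(n+4)^2)*L^2*(L-1)*r(n+2)
     +(9*(n+2)*(n+4)+(10*n^2+42*n+41))*L^2*(L-1)^2*(L-2)*r(n+1)
     -9*L^2*(L-1)^2*(L-2)^2*(L-3)*r n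
    = j^2*(j+1)^2*q j - 2*(2*j+1)*L^2*q(j+1)*(j+1)"
  unfolding L_def r_def q_def by algebra

definition num_avoiders :: "nat \<Rightarrow> real" where
  "num_avoiders n = real (card (inc_avoiders 4 n))"

definition recurrence_defect :: "nat \<Rightarrow> real" where
  "recurrence_defect n = (real n + 4)\<^sup>2 * num_avoiders (n + 2)
     - (10 * real n ^ 2 + 42 * real n + 41) * num_avoiders (n + 1) + 9 * (real n + 1)\<^sup>2 * num_avoiders n"

lemma recurrence_defect_Suc:
  "(real n + 4) * recurrence_defect (Suc n) = (real n + 2) * recurrence_defect n"
proof -
  define N where "N = real n"
  define q where "q j = 9*j^5-(144+45*N)*j^4+(829+516*N+80*N^2)*j^3-(1938+1823*N+574*N^2+60*N^3)*j^2
     +(1164+1588*N+828*N^2+190*N^3+16*N^4)*j+(944+1204*N+554*N^2+110*N^3+8*N^4)" for j :: real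
  define r where "r M j = M + 1 + 2 * M * j - j - 3 * j ^ 2" for M j :: real
  \<comment> \<open>The antidifference supplied by the certificate. The factor j^2 makes it vanish
    at 0, the binomial coefficient at n + 5, so the telescoping sum is 0.\<close>
  define G where "G j = real (2 * j choose j) * real (n + 4 choose j) ^ 2 * (real j ^ 2 * q (real j))" for j :: nat
  define t where "t k j = avoider_term (n + k) j" for k j
  have N: "N + 1 \<noteq> 0" "N + 2 \<noteq> 0" "N + 3 \<noteq> 0" "N + 4 \<noteq> 0" by (simp_all add: N_def add_eq_0_iff)
  \<comment> \<open>\<open>c\<close> clears those denominators in n that the coefficients of the
    recurrence do not already cancel.\<close>
  define c where "c = (N+2)*(N+3)^2*(N+4)^2"
  have summand: "c * ((N+4) * ((N+5)^2 * t 3 j - (10*N^2+62*N+93) * t 2 j + 9*(N+2)^2 * t 1 j)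
      - (N+2) * ((N+4)^2 * t 2 j - (10*N^2+42*N+41) * t 1 j + 9*(N+1)^2 * t 0 j)) = G j - G (Suc j)" for j
  proof -
    \<comment> \<open>All four summands become rational multiples of \<open>B\<close>, which belongs
      to the largest n involved, so that a polynomial identity remains.\<close>
    define J L B where "J = real j" and "L = N + 4 - J" and "B = real (2 * j choose j) * real (n + 4 choose j) ^ 2"
    have J: "J + 1 \<noteq> 0" by (simp add: J_def add_eq_0_iff)
    have b3: "real (n + 3 choose j) = real (n + 4 choose j) * L / (N + 4)"
      using real_binomial_Suc_left[of "n + 3" j] by (simp add: N_def J_def L_def eval_nat_numeral add_ac del: binomial_Suc_Suc)
    have b2: "real (n + 2 choose j) = real (n + 3 choose j) * (L - 1) / (N + 3)"
      using real_binomial_Suc_left[of "n + 2" j] by (simp add: N_def J_def L_def eval_nat_numeral add_ac del: binomial_Suc_Suc)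
    have b1: "real (n + 1 choose j) = real (n + 2 choose j) * (L - 2) / (N + 2)"
      using real_binomial_Suc_left[of "n + 1" j] by (simp add: N_def J_def L_def eval_nat_numeral add_ac del: binomial_Suc_Suc)
    have t3: "t 3 j = B * (L * r (N + 3) J) / ((N + 4)^2 * (J + 1)^2)"
      by (simp add: t_def avoider_term_def B_def N_def J_def L_def r_def eval_nat_numeral add_ac)
    have t2: "t 2 j = B * (L^2 * (L - 1) * r (N + 2) J) / ((N + 4)^2 * (N + 3)^2 * (J + 1)^2)"
    proof -
      have "t 2 j = real (2 * j choose j) * real (n + 3 choose j) ^ 2 * (L - 1) * r (N + 2) J / ((N + 3)^2 * (J + 1)^2)"
        by (simp add: t_def avoider_term_def N_def J_def L_def r_def eval_nat_numeral add_ac)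
      then show ?thesis unfolding b3 B_def power_divide power_mult_distrib by (simp add: mult_ac)
    qed
    have t1: "t 1 j = B * (L^2 * (L - 1)^2 * (L - 2) * r (N + 1) J) / ((N + 4)^2 * (N + 3)^2 * (N + 2)^2 * (J + 1)^2)"
    proof -
      have "t 1 j = real (2 * j choose j) * real (n + 2 choose j) ^ 2 * (L - 2) * r (N + 1) J / ((N + 2)^2 * (J + 1)^2)"
        by (simp add: t_def avoider_term_def N_def J_def L_def r_def eval_nat_numeral add_ac)
      then show ?thesis unfolding b2 b3 B_def power_divide power_mult_distrib by (simp add: mult_ac)
    qed
    have t0: "t 0 j = B * (L^2 * (L - 1)^2 * (L - 2)^2 * (L - 3) * r N J) / ((N + 4)^2 * (N + 3)^2 * (N + 2)^2 * (N + 1)^2 * (J + 1)^2)"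
    proof -
      have "t 0 j = real (2 * j choose j) * real (n + 1 choose j) ^ 2 * (L - 3) * r N J / ((N + 1)^2 * (J + 1)^2)"
        by (simp add: t_def avoider_term_def N_def J_def L_def r_def add_ac)
      then show ?thesis unfolding b1 b2 b3 B_def power_divide power_mult_distrib by (simp add: mult_ac)
    qed
    have G0: "G j = B * (J^2 * q J)" by (simp add: G_def B_def J_def)
    have G1: "G (Suc j) = B * (2 * (2 * J + 1) * L^2 * q (J + 1) * (J + 1)) / (J + 1)^2"
    proof -
      have "real (Suc j) = J + 1" by (simp add: J_def)
      moreover have "real (2 * Suc j choose Suc j) = real (2 * j choose j) * 2 * (2 * J + 1) / (J + 1)"
        using central_binomial_Suc(2) by (simp only: J_def)
      moreover have "real (n + 4 choose Suc j) = real (n + 4 choose j) * L / (J + 1)"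
        using real_binomial_Suc_right[of "n + 4" j] by (simp only: J_def L_def N_def of_nat_add of_nat_numeral)
      ultimately have "G (Suc j) = real (2 * j choose j) * 2 * (2 * J + 1) / (J + 1) * (real (n + 4 choose j) * L / (J + 1)) ^ 2 * ((J + 1)^2 * q (J + 1))"
        by (simp only: G_def)
      also have "\<dots> = B * (2 * (2 * J + 1) * L^2 * q (J + 1)) / (J + 1)"
        using J by (simp add: B_def power_divide power_mult_distrib)
      finally show ?thesis using J by (simp add: power2_eq_square)
    qed
    have cert: "(N+2)*(N+3)^2*(N+4)*(N+5)^2*L*r (N+3) J
       -((N+2)*(N+4)*(10*N^2+62*N+93)+(N+2)^2*(N+4)^2)*L^2*(L-1)*r (N+2) J
       +(9*(N+2)*(N+4)+(10*N^2+42*N+41))*L^2*(L-1)^2*(L-2)*r (N+1) J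
       -9*L^2*(L-1)^2*(L-2)^2*(L-3)*r N J
      = J^2*(J+1)^2*q J - 2*(2*J+1)*L^2*q (J+1)*(J+1)"
      unfolding L_def r_def q_def by (rule recurrence_certificate)
    define k where "k = B / (J + 1)^2"
    define R3 R2 R1 R0 where "R3 = k * (L * r (N + 3) J)"
      and "R2 = k * (L^2 * (L - 1) * r (N + 2) J)"
      and "R1 = k * (L^2 * (L - 1)^2 * (L - 2) * r (N + 1) J)"
      and "R0 = k * (L^2 * (L - 1)^2 * (L - 2)^2 * (L - 3) * r N J)"
    have T: "t 3 j = R3 / (N + 4)^2" "t 2 j = R2 / ((N + 4)^2 * (N + 3)^2)"
      "t 1 j = R1 / ((N + 4)^2 * (N + 3)^2 * (N + 2)^2)"
      "t 0 j = R0 / ((N + 4)^2 * (N + 3)^2 * (N + 2)^2 * (N + 1)^2)"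
      unfolding t3 t2 t1 t0 R3_def R2_def R1_def R0_def k_def by (simp_all add: mult_ac)
    have cT: "c * t 3 j = (N + 2) * (N + 3)^2 * R3" "c * t 2 j = (N + 2) * R2"
      "c * t 1 j = R1 / (N + 2)" "c * t 0 j = R0 / ((N + 2) * (N + 1)^2)"
      unfolding T c_def using N by (simp_all add: power2_eq_square)
    have "c * ((N+4) * ((N+5)^2 * t 3 j - (10*N^2+62*N+93) * t 2 j + 9*(N+2)^2 * t 1 j)
      - (N+2) * ((N+4)^2 * t 2 j - (10*N^2+42*N+41) * t 1 j + 9*(N+1)^2 * t 0 j))
      = (N+4)*(N+5)^2 * (c * t 3 j) - ((N+4)*(10*N^2+62*N+93) + (N+2)*(N+4)^2) * (c * t 2 j)
        + (9*(N+4)*(N+2)^2 + (N+2)*(10*N^2+42*N+41)) * (c * t 1 j) - 9*(N+2)*(N+1)^2 * (c * t 0 j)"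
      by (simp add: algebra_simps)
    also have "\<dots> = (N+2)*(N+3)^2*(N+4)*(N+5)^2 * R3 - ((N+2)*(N+4)*(10*N^2+62*N+93)+(N+2)^2*(N+4)^2) * R2
        + (9*(N+2)*(N+4)+(10*N^2+42*N+41)) * R1 - 9 * R0"
    proof -
      have "(9*(N+4)*(N+2)^2 + (N+2)*(10*N^2+42*N+41)) = (9*(N+2)*(N+4)+(10*N^2+42*N+41)) * (N + 2)"
        by (simp add: power2_eq_square algebra_simps)
      then have 1: "(9*(N+4)*(N+2)^2 + (N+2)*(10*N^2+42*N+41)) * (R1 / (N + 2)) = (9*(N+2)*(N+4)+(10*N^2+42*N+41)) * R1"
        using N by simp
      have m: "(N + 2) * (N + 1)^2 \<noteq> 0" using N by simp
      have "9 * m * (x / m) = 9 * x" if "m \<noteq> 0" for m x :: real using that by simp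
      from this[OF m, of R0] have 2: "9*(N+2)*(N+1)^2 * (R0 / ((N + 2) * (N + 1)^2)) = 9 * R0"
        by (simp only: mult.assoc)
      show ?thesis unfolding cT 1 2 by (simp add: power2_eq_square) (simp add: algebra_simps)
    qed
    also have "\<dots> = k * ((N+2)*(N+3)^2*(N+4)*(N+5)^2*L*r (N+3) J
       -((N+2)*(N+4)*(10*N^2+62*N+93)+(N+2)^2*(N+4)^2)*L^2*(L-1)*r (N+2) J
       +(9*(N+2)*(N+4)+(10*N^2+42*N+41))*L^2*(L-1)^2*(L-2)*r (N+1) J
       -9*L^2*(L-1)^2*(L-2)^2*(L-3)*r N J)"
      unfolding R3_def R2_def R1_def R0_def by (simp only: right_diff_distrib[of k] distrib_left[of k] mult_ac)
    also have "\<dots> = G j - G (Suc j)"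
      unfolding cert G0 G1 k_def using J by (simp add: field_simps)
    finally show ?thesis .
  qed
  have s: "num_avoiders (n + k) = (\<Sum>j\<le>n+4. t k j)" if "k < 4" for k
    using that by (simp add: num_avoiders_def t_def card_inc_avoiders_catalan[of "n + k" "n + 4"])
  have "c * ((N+4) * recurrence_defect (Suc n) - (N+2) * recurrence_defect n) =
    (\<Sum>j\<le>n+4. c * ((N+4) * ((N+5)^2 * t 3 j - (10*N^2+62*N+93) * t 2 j + 9*(N+2)^2 * t 1 j)
      - (N+2) * ((N+4)^2 * t 2 j - (10*N^2+42*N+41) * t 1 j + 9*(N+1)^2 * t 0 j)))"
  proof -
    have "recurrence_defect (Suc n) = (N+5)^2 * num_avoiders (n + 3) - (10*N^2+62*N+93) * num_avoiders (n + 2) + 9*(N+2)^2 * num_avoiders (n + 1)"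
      by (simp add: recurrence_defect_def N_def eval_nat_numeral algebra_simps)
    moreover have "recurrence_defect n = (N+4)^2 * num_avoiders (n + 2) - (10*N^2+42*N+41) * num_avoiders (n + 1) + 9*(N+1)^2 * num_avoiders (n + 0)"
      by (simp add: recurrence_defect_def N_def)
    moreover have "num_avoiders (n + 0) = sum (t 0) {..n+4}" "num_avoiders (n + 1) = sum (t 1) {..n+4}"
      "num_avoiders (n + 2) = sum (t 2) {..n+4}" "num_avoiders (n + 3) = sum (t 3) {..n+4}"
      by (rule s, simp)+
    ultimately show ?thesis
      by (simp only: sum_distrib_left[symmetric] sum.distrib sum_subtractf)
  qed
  also have "\<dots> = (\<Sum>j\<le>n+4. G j - G (Suc j))" unfolding summand ..
  also have "\<dots> = G 0 - G (Suc (n + 4))" by (rule sum_telescope)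
  also have "\<dots> = 0" by (simp add: G_def binomial_eq_0)
  finally have "(N+4) * recurrence_defect (Suc n) - (N+2) * recurrence_defect n = 0"
    using N by (simp add: c_def)
  then show ?thesis by (simp add: N_def)
qed

lemma num_avoiders_0_1_2: "num_avoiders 0 = 1" "num_avoiders 1 = 1" "num_avoiders 2 = 2"
proof -
  have s: "num_avoiders n = (\<Sum>j\<le>Suc n. avoider_term n j)" for n
    unfolding num_avoiders_def by (rule card_inc_avoiders_catalan) simp
  show "num_avoiders 0 = 1" "num_avoiders 1 = 1" "num_avoiders 2 = 2"
    unfolding s by (simp_all add: avoider_term_def eval_nat_numeral)
qed

text \<open>The first-order equation propagates a zero defect, and the defect at 0 is 16 * 2 - 41 +
  9 = 0.\<close>

lemma num_avoiders_recurrence: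
  "(real n + 4)\<^sup>2 * num_avoiders (n + 2) =
     (10 * real n ^ 2 + 42 * real n + 41) * num_avoiders (n + 1) - 9 * (real n + 1)\<^sup>2 * num_avoiders n"
proof -
  have "recurrence_defect n = 0"
  proof (induction n)
    case 0
    show ?case using num_avoiders_0_1_2 by (simp add: recurrence_defect_def eval_nat_numeral)
  next
    case (Suc n)
    then have "(real n + 4) * recurrence_defect (Suc n) = 0" by (simp add: recurrence_defect_Suc)
    moreover have "real n + 4 \<noteq> 0" by linarith
    ultimately show ?case by (metis mult_eq_0_iff)
  qed
  then show ?thesis by (simp add: recurrence_defect_def)
qed

section \<open>Ratio bounds and the order of growth\<close>

lemma num_avoiders_nonneg: "num_avoiders n \<ge> 0"
  by (simp add: num_avoiders_def)

text \<open>The bounding quotient 9(n+1)/(n+5) is the ratio of successive values of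
  \<open>9 ^ n / rising4 n\<close>. As S_n has a negative coefficient in the recurrence, an upper
  bound for one ratio yields one for the next. It reproduces itself because 10x^2 + 42x + 41 -
  (x+1)(x+5) = 9(x+2)^2 and (x+2)(x+6) \<le> (x+4)^2.\<close>

lemma num_avoiders_ratio_le: "(real n + 5) * num_avoiders (n + 1) \<le> 9 * (real n + 1) * num_avoiders n"
proof (induction n)
  case 0
  show ?case using num_avoiders_0_1_2 by simp
next
  case (Suc n)
  define x y where "x = real n" and "y = num_avoiders (n + 1)"
  have x: "x \<ge> 0" "y \<ge> 0" by (simp_all add: x_def y_def num_avoiders_nonneg)
  have "(x + 4)\<^sup>2 * num_avoiders (n + 2) = (10 * x ^ 2 + 42 * x + 41) * y - (x + 1) * (9 * (x + 1) * num_avoiders n)"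
    using num_avoiders_recurrence[of n] by (simp add: x_def y_def power2_eq_square mult_ac)
  also have "\<dots> \<le> (10 * x ^ 2 + 42 * x + 41) * y - (x + 1) * ((x + 5) * y)"
    using Suc x(1) by (intro diff_left_mono mult_left_mono) (simp_all add: x_def y_def)
  also have "\<dots> = 9 * (x + 2) * y * (x + 2)" by (simp add: power2_eq_square algebra_simps)
  finally have 1: "(x + 4)\<^sup>2 * num_avoiders (n + 2) \<le> 9 * (x + 2) * y * (x + 2)" .
  have "(x + 4)\<^sup>2 * ((x + 6) * num_avoiders (n + 2)) \<le> (x + 6) * (9 * (x + 2) * y * (x + 2))"
    using mult_left_mono[OF 1, of "x + 6"] x by (simp add: mult_ac)
  also have "\<dots> = (9 * (x + 2) * y) * ((x + 2) * (x + 6))" by (simp add: mult_ac)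
  also have "\<dots> \<le> (9 * (x + 2) * y) * (x + 4)\<^sup>2"
    using x by (intro mult_left_mono) (simp_all add: power2_eq_square algebra_simps)
  finally have "(x + 6) * num_avoiders (n + 2) \<le> 9 * (x + 2) * y"
    using x by (simp add: mult.commute[of _ "(x + 4)\<^sup>2"])
  then show ?case by (simp add: x_def y_def add_ac)
qed

text \<open>Without the shift by two the inequality fails at the start. With it the induction has
  the surplus 28x + 12, and the order of the resulting lower bound is unchanged.\<close>

lemma num_avoiders_ratio_ge: "(real n + 5) * num_avoiders (n + 3) \<ge> 9 * (real n + 1) * num_avoiders (n + 2)"
proof (induction n)
  case 0
  have "25 * num_avoiders 3 = 150"
    using num_avoiders_recurrence[of 1] num_avoiders_0_1_2 by (simp add: eval_nat_numeral)
  then show ?case using num_avoiders_0_1_2(3)[unfolded numeral_2_eq_2] by simp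
next
  case (Suc n)
  define x y where "x = real n" and "y = num_avoiders (n + 3)"
  have x: "x \<ge> 0" "y \<ge> 0" by (simp_all add: x_def y_def num_avoiders_nonneg)
  have E: "(x + 6)\<^sup>2 * num_avoiders (n + 4) = (10 * (x + 2) ^ 2 + 42 * (x + 2) + 41) * y - 9 * (x + 3)\<^sup>2 * num_avoiders (n + 2)"
    using num_avoiders_recurrence[of "n + 2"] by (simp add: x_def y_def eval_nat_numeral add_ac)
  have "(x + 1) * ((x + 6)\<^sup>2 * num_avoiders (n + 4)) =
      (x + 1) * (10 * (x + 2) ^ 2 + 42 * (x + 2) + 41) * y - (x + 3)\<^sup>2 * (9 * (x + 1) * num_avoiders (n + 2))"
    unfolding E right_diff_distrib by (simp only: mult_ac)
  also have "\<dots> \<ge> (x + 1) * (10 * (x + 2) ^ 2 + 42 * (x + 2) + 41) * y - (x + 3)\<^sup>2 * ((x + 5) * y)"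
    using Suc x(1) by (intro diff_left_mono mult_left_mono) (simp_all add: x_def y_def)
  finally have 1: "(x + 1) * (10 * (x + 2) ^ 2 + 42 * (x + 2) + 41) * y - (x + 3)\<^sup>2 * ((x + 5) * y)
      \<le> (x + 1) * ((x + 6)\<^sup>2 * num_avoiders (n + 4))" .
  have "(x + 1) * (x + 6) * (9 * (x + 2) * y) + (28 * x + 12) * y =
     (x + 1) * (10 * (x + 2) ^ 2 + 42 * (x + 2) + 41) * y - (x + 3)\<^sup>2 * ((x + 5) * y)"
    by (simp add: power2_eq_square algebra_simps)
  moreover have "(28 * x + 12) * y \<ge> 0" using x by simp
  ultimately have "(x + 1) * (x + 6) * (9 * (x + 2) * y) \<le> (x + 1) * (x + 6) * ((x + 6) * num_avoiders (n + 4))"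
    using 1 by (simp add: power2_eq_square mult_ac)
  then have "9 * (x + 2) * y \<le> (x + 6) * num_avoiders (n + 4)"
    using x by (subst (asm) mult_le_cancel_left_pos) simp_all
  then show ?case by (simp add: x_def y_def eval_nat_numeral add_ac)
qed

text \<open>A rising factorial in place of n^4: its successive quotients are the ratios above, and
  it can be absorbed into binomial coefficients.\<close>

definition rising4 :: "nat \<Rightarrow> real" where
  "rising4 n = (real n + 1) * (real n + 2) * (real n + 3) * (real n + 4)"

lemma rising4_pos: "rising4 n > 0"
  unfolding rising4_def by (intro mult_pos_pos) linarith+

lemma rising4_Suc: "rising4 (Suc n) * (real n + 1) = rising4 n * (real n + 5)"
  by (simp add: rising4_def algebra_simps)

lemma num_avoiders_upper: "num_avoiders n * rising4 n \<le> 24 * 9 ^ n"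
proof (induction n)
  case 0
  show ?case using num_avoiders_0_1_2 by (simp add: rising4_def)
next
  case (Suc n)
  have "(real n + 1) * (num_avoiders (Suc n) * rising4 (Suc n)) = rising4 n * ((real n + 5) * num_avoiders (n + 1))"
    using rising4_Suc[of n] by (simp add: mult_ac)
  also have "\<dots> \<le> rising4 n * (9 * (real n + 1) * num_avoiders n)"
    using rising4_pos[of n] num_avoiders_ratio_le by (intro mult_left_mono) auto
  also have "\<dots> \<le> (real n + 1) * (9 * (24 * 9 ^ n))"
  proof -
    have "0 \<le> 9 * (real n + 1)" by simp
    from mult_left_mono[OF Suc this] show ?thesis by (simp only: mult_ac)
  qed
  finally show ?case by simp
qed

text \<open>The constant gives equality at the start of the shifted induction, 2 * 24 = 16/27 *
  9^2.\<close>

lemma num_avoiders_lower: "num_avoiders n * rising4 n \<ge> 16 / 27 * 9 ^ n"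
proof -
  have *: "num_avoiders (n + 2) * rising4 n \<ge> 16 / 27 * 9 ^ (n + 2)" for n
  proof (induction n)
    case 0
    show ?case using num_avoiders_0_1_2 by (simp add: rising4_def eval_nat_numeral)
  next
    case (Suc n)
    have "(real n + 1) * (9 * (16 / 27 * 9 ^ (n + 2))) \<le> (real n + 1) * (9 * (num_avoiders (n + 2) * rising4 n))"
      using Suc by (intro mult_left_mono) auto
    also have "\<dots> = rising4 n * (9 * (real n + 1) * num_avoiders (n + 2))" by (simp add: mult_ac)
    also have "\<dots> \<le> rising4 n * ((real n + 5) * num_avoiders (n + 3))"
      using rising4_pos[of n] num_avoiders_ratio_ge by (intro mult_left_mono) auto
    also have "\<dots> = (real n + 1) * (num_avoiders (n + 3) * rising4 (Suc n))"
      using rising4_Suc[of n] by (simp add: mult_ac)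
    finally show ?case by (simp add: eval_nat_numeral)
  qed
  consider "n = 0" | "n = 1" | m where "n = m + 2"
    by (metis One_nat_def add_2_eq_Suc' not0_implies_Suc)
  then show ?thesis
  proof cases
    case 3
    have "rising4 m \<le> rising4 n" unfolding rising4_def 3 by (intro mult_mono) auto
    then show ?thesis using *[of m] mult_left_mono[of "rising4 m" "rising4 n" "num_avoiders n"] num_avoiders_nonneg
      unfolding 3 by (meson order_trans)
  qed (use num_avoiders_0_1_2 in \<open>simp_all add: rising4_def\<close>)
qed

definition binomial_avoiders :: "nat \<Rightarrow> real" where
  "binomial_avoiders n = (\<Sum>m\<le>n. real (n choose m) * num_avoiders m)"

text \<open>A fourfold absorption identity. It trades the denominator \<open>rising4 m\<close>
  inside the binomial transform for \<open>rising4 n\<close> outside, at the cost of a shift by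
  4.\<close>

lemma binomial_rising4: "real (n + 4 choose (m + 4)) * rising4 m = real (n choose m) * rising4 n"
proof -
  have step: "real (Suc n choose Suc k) * (real k + 1) = real (n choose k) * (real n + 1)" for n k
    using real_binomial_Suc_Suc[of n k] by (simp add: field_simps del: binomial_Suc_Suc)
  have s: "n + 4 = Suc (Suc (Suc (Suc n)))" for n by simp
  show ?thesis
    unfolding s rising4_def
    using step[of "Suc (Suc (Suc n))" "Suc (Suc (Suc m))"] step[of "Suc (Suc n)" "Suc (Suc m)"]
      step[of "Suc n" "Suc m"] step[of n m]
    by (simp add: add_ac mult_ac del: binomial_Suc_Suc)
qed

text \<open>After absorption the sum is a part of the expansion of (9 + 1)^(n+4). The lower bound
  needs no absorption, only the monotonicity of \<open>rising4\<close>.\<close>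

lemma binomial_avoiders_upper: "binomial_avoiders n * rising4 n \<le> 24 * (10 ^ (n + 4) / 9 ^ 4)"
proof -
  have "binomial_avoiders n * rising4 n = (\<Sum>m\<le>n. real (n + 4 choose (m + 4)) * (num_avoiders m * rising4 m))"
    unfolding binomial_avoiders_def sum_distrib_right
    by (rule sum.cong) (use binomial_rising4 in \<open>simp_all add: mult_ac\<close>)
  also have "\<dots> \<le> (\<Sum>m\<le>n. real (n + 4 choose (m + 4)) * (24 * 9 ^ m))"
    by (intro sum_mono mult_left_mono num_avoiders_upper) auto
  also have "\<dots> = 24 / 9 ^ 4 * (\<Sum>m=0..n. real (n + 4 choose (m + 4)) * 9 ^ (m + 4))"
    unfolding atLeast0AtMost sum_distrib_left by (rule sum.cong) (simp_all add: power_add)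
  also have "(\<Sum>m=0..n. real (n + 4 choose (m + 4)) * 9 ^ (m + 4)) = (\<Sum>k=0+4..n+4. real (n + 4 choose k) * 9 ^ k)"
    by (rule sum.shift_bounds_cl_nat_ivl[symmetric])
  also have "24 / 9 ^ 4 * \<dots> \<le> 24 / 9 ^ 4 * (\<Sum>k\<le>n+4. real (n + 4 choose k) * 9 ^ k)"
    by (intro mult_left_mono sum_mono2) auto
  also have "(\<Sum>k\<le>n+4. real (n + 4 choose k) * 9 ^ k) = 10 ^ (n + 4)"
    using binomial_ring[of 9 "1::real" "n + 4"] by simp
  finally show ?thesis by simp
qed

lemma binomial_avoiders_lower: "binomial_avoiders n * rising4 n \<ge> 16 / 27 * 10 ^ n"
proof -
  have "10 ^ n = (\<Sum>m\<le>n. real (n choose m) * 9 ^ m)"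
    using binomial_ring[of 9 "1::real" n] by simp
  then have "16 / 27 * 10 ^ n = (\<Sum>m\<le>n. real (n choose m) * (16 / 27 * 9 ^ m))"
    by (simp add: sum_distrib_left mult_ac)
  also have "\<dots> \<le> (\<Sum>m\<le>n. real (n choose m) * (num_avoiders m * rising4 n))"
  proof (intro sum_mono mult_left_mono)
    fix m assume "m \<in> {..n}"
    then have "rising4 m \<le> rising4 n" unfolding rising4_def by (intro mult_mono) auto
    then show "16 / 27 * 9 ^ m \<le> num_avoiders m * rising4 n"
      using num_avoiders_lower[of m] mult_left_mono[of "rising4 m" "rising4 n" "num_avoiders m"] num_avoiders_nonneg
      by (meson order_trans)
  qed auto
  also have "\<dots> = binomial_avoiders n * rising4 n" 
    unfolding binomial_avoiders_def sum_distrib_right by (rule sum.cong) (simp_all add: mult_ac)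
  finally show ?thesis .
qed

section \<open>Permutations that avoid the four patterns\<close>

definition ends_inc4 :: "nat list \<Rightarrow> nat \<Rightarrow> bool" where
  "ends_inc4 p j \<longleftrightarrow> (\<exists>a b c. a < b \<and> b < c \<and> c < j \<and> p ! a < p ! b \<and> p ! b < p ! c \<and> p ! c < p ! j)"

lemma has_inc_4_iff: "has_inc 4 p \<longleftrightarrow> (\<exists>j<length p. ends_inc4 p j)"
proof
  assume "has_inc 4 p"
  then obtain ys where ys: "subseq ys p" "sorted_wrt (<) ys" "length ys = 4"
    unfolding has_inc_def by blast
  then obtain x y z w where xyzw: "ys = [x, y, z, w]"
    by (auto simp: length_Suc_conv numeral_eq_Suc)
  obtain u0 r0 where 0: "p = u0 @ x # r0" "subseq [y, z, w] r0"
    using ys(1) unfolding xyzw by (auto dest: list_emb_ConsD)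
  obtain u1 r1 where 1: "r0 = u1 @ y # r1" "subseq [z, w] r1"
    using 0(2) by (auto dest: list_emb_ConsD)
  obtain u2 r2 where 2: "r1 = u2 @ z # r2" "subseq [w] r2"
    using 1(2) by (auto dest: list_emb_ConsD)
  obtain u3 r3 where 3: "r2 = u3 @ w # r3"
    using 2(2) by (auto dest: list_emb_ConsD)
  define a b c d where "a = length u0" and "b = a + Suc (length u1)" and "c = b + Suc (length u2)"
    and "d = c + Suc (length u3)"
  have p: "p = u0 @ x # u1 @ y # u2 @ z # u3 @ w # r3" using 0 1 2 3 by simp
  have "p ! a = x" "p ! b = y" "p ! c = z" "p ! d = w" "d < length p"
    unfolding p by (simp_all add: a_def b_def c_def d_def nth_append)
  moreover have "a < b" "b < c" "c < d" by (simp_all add: b_def c_def d_def)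
  ultimately show "\<exists>j<length p. ends_inc4 p j"
    using ys(2) unfolding ends_inc4_def xyzw by (intro exI[of _ d]) auto
next
  assume "\<exists>j<length p. ends_inc4 p j"
  then obtain a b c d where d: "d < length p" "a < b" "b < c" "c < d"
    "p ! a < p ! b" "p ! b < p ! c" "p ! c < p ! d" unfolding ends_inc4_def by blast
  have "subseq [a, b, c, d] [0..<length p]"
    using d by (intro sorted_subset_imp_subseq) auto
  then have "subseq (map ((!) p) [a, b, c, d]) (map ((!) p) [0..<length p])" by (rule subseq_map)
  then have "subseq [p ! a, p ! b, p ! c, p ! d] p" by (simp add: map_nth)
  then show "has_inc 4 p" unfolding has_inc_def using d by (intro exI[of _ "[p ! a, p ! b, p ! c, p ! d]"]) auto
qed

lemma ends_inc4_take: "j < m \<Longrightarrow> m \<le> length p \<Longrightarrow> ends_inc4 (take m p) j \<longleftrightarrow> ends_inc4 p j"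
  unfolding ends_inc4_def by (intro ex_cong1 conj_cong refl) auto

text \<open>Each pattern is an increasing quadruple followed by an entry below its top, and the four
  patterns exhaust the possible relative values of that last entry.\<close>

lemma contains_A55_iff:
  assumes "distinct p"
  shows "(\<exists>q\<in>A55. contains_pattern p q) \<longleftrightarrow>
    (\<exists>j k. ends_inc4 p j \<and> j < k \<and> k < length p \<and> p ! k < p ! j)"
proof
  assume "\<exists>q\<in>A55. contains_pattern p q"
  then obtain q where q: "q \<in> A55" "contains_pattern p q" by blast
  have l: "length q = 5" using q(1) by (auto simp: A55_def)
  obtain i where i: "strict_mono_on {..<5} i" "\<forall>r<5. i r < length p"
    "\<forall>r<5. \<forall>s<5. p ! i r < p ! i s \<longleftrightarrow> q ! r < q ! s"
    using q(2) unfolding contains_pattern_def l by blast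
  have "i 0 < i 1" "i 1 < i 2" "i 2 < i 3" "i 3 < i 4"
    using i(1) by (auto simp: strict_mono_on_def)
  moreover have "q ! 0 < q ! 1" "q ! 1 < q ! 2" "q ! 2 < q ! 3" "q ! 4 < q ! 3"
    using q(1) by (auto simp: A55_def)
  ultimately show "\<exists>j k. ends_inc4 p j \<and> j < k \<and> k < length p \<and> p ! k < p ! j"
    unfolding ends_inc4_def using i(2,3) by (intro exI[of _ "i 3"] exI[of _ "i 4"] conjI exI[of _ "i 0"] exI[of _ "i 1"] exI[of _ "i 2"]) auto
next
  assume "\<exists>j k. ends_inc4 p j \<and> j < k \<and> k < length p \<and> p ! k < p ! j"
  then obtain a b c j k where *: "a < b" "b < c" "c < j" "j < k" "k < length p"
    "p ! a < p ! b" "p ! b < p ! c" "p ! c < p ! j" "p ! k < p ! j"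
    unfolding ends_inc4_def by blast
  define i where "i r = [a, b, c, j, k] ! r" for r
  have mono: "strict_mono_on {..<5} i"
  proof (rule strict_mono_onI)
    fix r s :: nat assume "s \<in> {..<5}" "r < s"
    then show "i r < i s" unfolding i_def using *(1-4)
      by (intro sorted_wrt_nth_less[of "(<)" "[a, b, c, j, k]"]) auto
  qed
  have len: "\<forall>r<5. i r < length p"
    using * by (auto simp: i_def numeral_eq_Suc less_Suc_eq)
  have contains: "contains_pattern p q"
    if "length q = 5" "\<forall>r<5. \<forall>s<5. p ! i r < p ! i s \<longleftrightarrow> q ! r < q ! s" for q
    unfolding contains_pattern_def using that mono len by auto
  have ne: "p ! k \<noteq> p ! a" "p ! k \<noteq> p ! b" "p ! k \<noteq> p ! c"
    using * assms by (auto simp: nth_eq_iff_index_eq)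
  consider "p ! k < p ! a" | "p ! a < p ! k" "p ! k < p ! b" | "p ! b < p ! k" "p ! k < p ! c" | "p ! c < p ! k"
    using ne by linarith
  then show "\<exists>q\<in>A55. contains_pattern p q"
  proof cases
    case 1
    have "contains_pattern p [2,3,4,5,1]"
      by (rule contains) (use 1 * in \<open>auto simp: i_def numeral_eq_Suc less_Suc_eq\<close>)
    then show ?thesis by (auto simp: A55_def)
  next
    case 2
    have "contains_pattern p [1,3,4,5,2]"
      by (rule contains) (use 2 * in \<open>auto simp: i_def numeral_eq_Suc less_Suc_eq\<close>)
    then show ?thesis by (auto simp: A55_def)
  next
    case 3
    have "contains_pattern p [1,2,4,5,3]"
      by (rule contains) (use 3 * in \<open>auto simp: i_def numeral_eq_Suc less_Suc_eq\<close>)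
    then show ?thesis by (auto simp: A55_def)
  next
    case 4
    have "contains_pattern p [1,2,3,5,4]"
      by (rule contains) (use 4 * in \<open>auto simp: i_def numeral_eq_Suc less_Suc_eq\<close>)
    then show ?thesis by (auto simp: A55_def)
  qed
qed

lemma Av_A55_iff:
  "p \<in> Av n A55 \<longleftrightarrow> p \<in> permutations_of_set {1..n} \<and>
     (\<forall>j k. ends_inc4 p j \<longrightarrow> j < k \<longrightarrow> k < length p \<longrightarrow> p ! j \<le> p ! k)"
proof (cases "p \<in> permutations_of_set {1..n}")
  case True
  then have "distinct p" by (simp add: permutations_of_set_def)
  from contains_A55_iff[OF this] have "(\<forall>q\<in>A55. \<not> contains_pattern p q) \<longleftrightarrow>
      (\<forall>j k. ends_inc4 p j \<longrightarrow> j < k \<longrightarrow> k < length p \<longrightarrow> p ! j \<le> p ! k)"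
    unfolding not_less[symmetric] by blast
  then show ?thesis using True unfolding Av_def by simp
qed (simp add: Av_def)

section \<open>Counting by prefix and increasing tail\<close>

definition set_avoiders :: "nat set \<Rightarrow> nat list set" where
  "set_avoiders A = {xs \<in> permutations_of_set A. \<not> has_inc 4 xs}"

lemma finite_set_avoiders [simp]: "finite (set_avoiders A)"
  by (simp add: set_avoiders_def)

lemma has_inc_map:
  assumes "strict_mono_on (set xs) f"
  shows "has_inc 4 (map f xs) \<longleftrightarrow> has_inc 4 xs"
proof -
  have lt: "f (xs ! a) < f (xs ! b) \<longleftrightarrow> xs ! a < xs ! b" if "a < length xs" "b < length xs" for a b
    using assms that by (intro strict_mono_on_less[of "set xs" f]) auto
  have "ends_inc4 (map f xs) j \<longleftrightarrow> ends_inc4 xs j" if j: "j < length xs" for j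
    unfolding ends_inc4_def using j by (intro ex_cong1 conj_cong refl) (auto simp: lt)
  then show ?thesis unfolding has_inc_4_iff by auto
qed

lemma card_set_avoiders:
  assumes "finite A"
  shows "card (set_avoiders A) = card (inc_avoiders 4 (card A))"
proof -
  obtain h0 where h0: "bij_betw h0 {..<card A} A" "strict_mono_on {..<card A} h0"
    using ex_bij_betw_strict_mono_card[OF assms] by blast
  \<comment> \<open>The enumeration \<open>h0\<close> starts at index 0, whereas the permutations
    have values from 1.\<close>
  define h where "h = h0 \<circ> (\<lambda>i. i - 1)"
  have "bij_betw (\<lambda>i. i - 1) {1..card A} {..<card A}"
    by (rule bij_betw_byWitness[where f' = Suc]) auto
  then have h: "bij_betw h {1..card A} A" unfolding h_def by (rule bij_betw_trans) (rule h0(1))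
  have h': "strict_mono_on {1..card A} h"
    by (rule strict_mono_onI) (auto simp: h_def intro!: strict_mono_onD[OF h0(2)])
  have inj: "inj_on h {1..card A}" and im: "h ` {1..card A} = A" using h by (auto simp: bij_betw_def)
  have "bij_betw (map h) (inc_avoiders 4 (card A)) (set_avoiders A)"
  proof (rule bij_betw_imageI)
    show "inj_on (map h) (inc_avoiders 4 (card A))"
      by (rule inj_onI) (metis inj inc_avoidersD(1) map_inj_on sup.idem)
    show "map h ` inc_avoiders 4 (card A) = set_avoiders A"
    proof (intro equalityI subsetI)
      fix q assume "q \<in> map h ` inc_avoiders 4 (card A)"
      then obtain p where p: "p \<in> inc_avoiders 4 (card A)" "q = map h p" by auto
      note d = inc_avoidersD[OF p(1)]
      show "q \<in> set_avoiders A"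
        using d inj im h' has_inc_map[of p h]
        by (simp add: set_avoiders_def permutations_of_set_def p(2) distinct_map)
    next
      fix q assume q: "q \<in> set_avoiders A"
      define g where "g = inv_into {1..card A} h"
      define p where "p = map g q"
      have qA: "set q = A" "distinct q" "\<not> has_inc 4 q" using q by (auto simp: set_avoiders_def permutations_of_set_def)
      have hg: "h (g x) = x" if "x \<in> A" for x using that im by (simp add: g_def f_inv_into_f)
      have qp: "q = map h p" unfolding p_def map_map by (rule sym, rule map_idI) (use hg qA in auto)
      have gA: "bij_betw g A {1..card A}" unfolding g_def by (rule bij_betw_inv_into[OF h])
      have "set p = {1..card A}" "distinct p"
        using gA qA by (auto simp: p_def bij_betw_def distinct_map)
      then have "p \<in> inc_avoiders 4 (card A)"
        using qA(3) has_inc_map[of p h] h' unfolding qp by (simp add: inc_avoiders_def permutations_of_set_def)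
      then show "q \<in> map h ` inc_avoiders 4 (card A)" using qp by blast
    qed
  qed
  then show ?thesis by (simp add: bij_betw_same_card)
qed

lemma sum_Pow_card:
  assumes "finite S"
  shows "(\<Sum>A\<in>Pow S. f (card A)) = (\<Sum>m\<le>card S. of_nat (card S choose m) * (f m :: 'a::semiring_1))"
proof -
  have "(\<Sum>A\<in>Pow S. f (card A)) = (\<Sum>m\<le>card S. \<Sum>A\<in>{A \<in> Pow S. card A = m}. f (card A))"
    using assms by (intro sum.group[symmetric]) (auto intro: card_mono)
  also have "\<dots> = (\<Sum>m\<le>card S. of_nat (card S choose m) * f m)"
    by (rule sum.cong) (use n_subsets[OF assms] in auto)
  finally show ?thesis .
qed

text \<open>After the first entry that ends an increasing quadruple all entries increase and end
  quadruples themselves. The tail is then determined by the set of values of the prefix. The union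
  bound makes uniqueness of the decomposition irrelevant here.\<close>

lemma card_Av_A55_le: "card (Av n A55) \<le> (\<Sum>m\<le>n. (n choose m) * card (inc_avoiders 4 m))"
proof -
  have "Av n A55 \<subseteq> (\<Union>A\<in>Pow {1..n}. (\<lambda>xs. xs @ sorted_list_of_set ({1..n} - A)) ` set_avoiders A)"
  proof
    fix p assume p: "p \<in> Av n A55"
    then have set: "set p = {1..n}" and dist: "distinct p"
      and mono: "\<And>j k. ends_inc4 p j \<Longrightarrow> j < k \<Longrightarrow> k < length p \<Longrightarrow> p ! j \<le> p ! k"
      by (auto simp: Av_A55_iff permutations_of_set_def)
    \<comment> \<open>If no entry ends an increasing quadruple, \<open>m\<close> is the length of
      \<open>p\<close> and the tail is empty.\<close>
    define m where "m = (LEAST j. j = length p \<or> ends_inc4 p j)"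
    have m: "m \<le> length p" "\<And>j. j < m \<Longrightarrow> \<not> ends_inc4 p j" "m < length p \<Longrightarrow> ends_inc4 p m"
    proof -
      show "m \<le> length p" unfolding m_def by (rule Least_le) simp
      show "\<not> ends_inc4 p j" if "j < m" for j
        using not_less_Least[OF that[unfolded m_def]] by simp
      have "m = length p \<or> ends_inc4 p m"
        unfolding m_def by (rule LeastI[of _ "length p"]) simp
      then show "ends_inc4 p m" if "m < length p" using that by simp
    qed
    have tail: "ends_inc4 p j" if "m \<le> j" "j < length p" for j
      using that
    proof (induction j rule: dec_induct)
      case base then show ?case using m(3) by simp
    next
      case (step j)
      then have e: "ends_inc4 p j" by simp
      have "p ! j \<le> p ! Suc j" using mono[OF e] step by simp
      moreover obtain a b c where "a < b" "b < c" "c < j" "p ! a < p ! b" "p ! b < p ! c" "p ! c < p ! j"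
        using e unfolding ends_inc4_def by blast
      ultimately show ?case unfolding ends_inc4_def
        by (intro exI[of _ a] exI[of _ b] exI[of _ c]) auto
    qed
    define A where "A = set (take m p)"
    have "\<not> has_inc 4 (take m p)"
      unfolding has_inc_4_iff using m(1,2) ends_inc4_take[of _ m p] by auto
    then have 1: "take m p \<in> set_avoiders A"
      using dist by (simp add: set_avoiders_def permutations_of_set_def A_def)
    have 2: "A \<subseteq> {1..n}" unfolding A_def using set set_take_subset by fast
    have "sorted (drop m p)"
      unfolding sorted_iff_nth_mono_less using tail mono by auto
    moreover have "set (drop m p) = {1..n} - A"
    proof -
      have "set (take m p) \<union> set (drop m p) = {1..n}" using set by (metis append_take_drop_id set_append)
      moreover have "set (take m p) \<inter> set (drop m p) = {}" using dist by (simp add: set_take_disj_set_drop_if_distinct)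
      ultimately show ?thesis unfolding A_def by blast
    qed
    ultimately have "drop m p = sorted_list_of_set ({1..n} - A)"
      using dist by (metis distinct_drop sorted_list_of_set.idem_if_sorted_distinct)
    then have "p = take m p @ sorted_list_of_set ({1..n} - A)" by (metis append_take_drop_id)
    then show "p \<in> (\<Union>A\<in>Pow {1..n}. (\<lambda>xs. xs @ sorted_list_of_set ({1..n} - A)) ` set_avoiders A)"
      using 1 2 by blast
  qed
  then have "card (Av n A55) \<le> card (\<Union>A\<in>Pow {1..n}. (\<lambda>xs. xs @ sorted_list_of_set ({1..n} - A)) ` set_avoiders A)"
    by (intro card_mono) auto
  also have "\<dots> \<le> (\<Sum>A\<in>Pow {1..n}. card ((\<lambda>xs. xs @ sorted_list_of_set ({1..n} - A)) ` set_avoiders A))"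
    by (rule card_UN_le) simp
  also have "\<dots> \<le> (\<Sum>A\<in>Pow {1..n}. card (inc_avoiders 4 (card A)))"
  proof (rule sum_mono)
    fix A assume "A \<in> Pow {1..n}"
    then have "finite A" using finite_subset by blast
    then show "card ((\<lambda>xs. xs @ sorted_list_of_set ({1..n} - A)) ` set_avoiders A) \<le> card (inc_avoiders 4 (card A))"
      using card_image_le[OF finite_set_avoiders[of A]] card_set_avoiders[of A] by simp
  qed
  also have "\<dots> = (\<Sum>m\<le>n. (n choose m) * card (inc_avoiders 4 m))"
    using sum_Pow_card[of "{1..n}" "\<lambda>m. card (inc_avoiders 4 m)"] by simp
  finally show ?thesis .
qed

text \<open>The entry 1 separates the prefix from the increasing tail and makes the decomposition unique.\<close>

lemma card_Av_A55_ge: "(\<Sum>m\<le>n. (n choose m) * card (inc_avoiders 4 m)) \<le> card (Av (Suc n) A55)"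
proof -
  define S where "S = {2..Suc n}"
  define f where "f = (\<lambda>(A, xs). xs @ 1 # sorted_list_of_set (S - A))"
  define D where "D = (SIGMA A : Pow S. set_avoiders A)"
  have D: "set xs = A" "distinct xs" "\<not> has_inc 4 xs" "A \<subseteq> S" "1 \<notin> A" "finite A" if "(A, xs) \<in> D" for A xs
    using that finite_subset[of A S] by (auto simp: D_def set_avoiders_def permutations_of_set_def S_def)
  have "inj_on f D"
  proof (rule inj_onI, clarify)
    fix A xs B ys assume *: "(A, xs) \<in> D" "(B, ys) \<in> D" "f (A, xs) = f (B, ys)"
    have "1 \<notin> set xs" "1 \<notin> set (sorted_list_of_set (S - A))"
      using D[OF *(1)] by (auto simp: S_def)
    from append_Cons_eq_iff[OF this] have "xs = ys"
      using *(3) by (simp only: f_def case_prod_conv)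
    then show "A = B \<and> xs = ys" using D(1)[OF *(1)] D(1)[OF *(2)] by simp
  qed
  moreover have "f ` D \<subseteq> Av (Suc n) A55"
  proof clarify
    fix A xs assume "(A, xs) \<in> D"
    note d = D[OF this]
    define ts where "ts = sorted_list_of_set (S - A)"
    define p where "p = xs @ 1 # ts"
    have ts: "set ts = S - A" "sorted ts" "distinct ts" by (simp_all add: ts_def S_def)
    have "set p = {1..Suc n}" using d(1,4) ts(1) by (auto simp: p_def S_def)
    moreover have "distinct p" using d ts by (auto simp: p_def S_def)
    moreover have "p ! j \<le> p ! k" if j: "ends_inc4 p j" "j < k" "k < length p" for j k
    proof -
      \<comment> \<open>A prefix entry ends no quadruple, the entry 1 ends none since it is the
        least, and a tail entry is followed only by larger ones.\<close>
      consider "j < length xs" | "j = length xs" | "length xs < j" by linarith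
      then show ?thesis
      proof cases
        case 1
        have "ends_inc4 xs j" using j(1) 1 ends_inc4_take[of j "length xs" p] by (simp add: p_def)
        then show ?thesis using 1 d(3) has_inc_4_iff by blast
      next
        case 2
        then have "p ! j = 1" by (simp add: p_def)
        then show ?thesis using j(1) unfolding ends_inc4_def by auto
      next
        case 3
        then have "p ! j = ts ! (j - Suc (length xs))" "p ! k = ts ! (k - Suc (length xs))"
          using j(2) by (simp_all add: p_def nth_append nth_Cons')
        then show ?thesis using sorted_nth_mono[OF ts(2)] 3 j(2,3) by (simp add: p_def)
      qed
    qed
    ultimately have "p \<in> Av (Suc n) A55" by (simp add: Av_A55_iff permutations_of_set_def)
    then show "f (A, xs) \<in> Av (Suc n) A55" by (simp add: f_def p_def ts_def)
  qed
  ultimately have "card D \<le> card (Av (Suc n) A55)"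
    by (intro card_inj_on_le) (auto simp: Av_def)
  moreover have "card D = (\<Sum>A\<in>Pow S. card (inc_avoiders 4 (card A)))"
    unfolding D_def by (subst card_SigmaI) (auto simp: S_def intro!: sum.cong card_set_avoiders intro: finite_subset)
  moreover have "\<dots> = (\<Sum>m\<le>n. (n choose m) * card (inc_avoiders 4 m))"
    using sum_Pow_card[of S "\<lambda>m. card (inc_avoiders 4 m)"] by (simp add: S_def)
  ultimately show ?thesis by simp
qed

section \<open>Logarithmic growth is not algebraic\<close>

text \<open>A polynomial in two variables is represented by its coefficients in the outer variable, so that
  \<open>poly (poly Q [:y:]) w\<close> is its value at outer variable \<open>y\<close> and inner variable \<open>w\<close>.\<close>

lemma poly_poly_const: "poly (poly Q c) w = poly (poly Q [:poly c w:]) (w::'a::comm_ring_1)"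
  by (induction Q) simp_all

lemma poly_poly_altdef:
  "poly (poly Q [:y:]) w = (\<Sum>i\<le>degree Q. poly (coeff Q i) w * (y::'a::comm_ring_1) ^ i)"
  unfolding poly_altdef[of Q "[:y:]"]
  by (simp only: poly_sum poly_mult poly_power poly_pCons poly_0 mult_zero_right add_0_right)

text \<open>The common power of the linear factor is divided out of all coefficients; the degree of
  the leading coefficient drops each time.\<close>

lemma poly_poly_extract_root:
  fixes Q :: "'a::field poly poly"
  assumes "Q \<noteq> 0"
  shows "\<exists>m Q'. Q = smult ([:- a, 1:] ^ m) Q' \<and> (\<exists>i. poly (coeff Q' i) a \<noteq> 0)"
  using assms
proof (induction "degree (lead_coeff Q)" arbitrary: Q rule: less_induct)
  case less
  show ?case
  proof (cases "\<exists>i. poly (coeff Q i) a \<noteq> 0")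
    case True
    then show ?thesis by (intro exI[of _ 0] exI[of _ Q]) simp
  next
    case False
    then have "[:[:- a, 1:]:] dvd Q" by (simp add: const_poly_dvd_iff poly_eq_0_iff_dvd)
    then obtain R where R: "Q = smult [:- a, 1:] R" by (auto elim: dvdE)
    have "R \<noteq> 0" using less.prems R by auto
    moreover have "degree (lead_coeff R) < degree (lead_coeff Q)"
    proof -
      have "lead_coeff R \<noteq> 0" using \<open>R \<noteq> 0\<close> by simp
      then have "degree ([:- a, 1:] * lead_coeff R) = Suc (degree (lead_coeff R))"
        by (subst degree_mult_eq) auto
      then show ?thesis unfolding R lead_coeff_smult by simp
    qed
    ultimately obtain m Q' where "R = smult ([:- a, 1:] ^ m) Q'" "\<exists>i. poly (coeff Q' i) a \<noteq> 0"
      using less.hyps by blast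
    then show ?thesis using R by (intro exI[of _ "Suc m"] exI[of _ Q']) simp
  qed
qed

text \<open>After a common power of w - 1 is removed, let J be the largest index whose coefficient
  does not vanish at 1, and divide by g^J. Lower terms vanish because g tends to infinity; higher
  ones contain a factor 1 - w that beats every power of g. The limit is the nonzero coefficient at
  J.\<close>

lemma no_algebraic_log_growth:
  fixes Q :: "complex poly poly" and g :: "real \<Rightarrow> real"
  assumes Q: "Q \<noteq> 0"
    and g: "filterlim g at_top (at_left 1)"
    and slow: "\<And>k. ((\<lambda>w. (1 - w) * g w ^ k) \<longlongrightarrow> 0) (at_left 1)"
    and zero: "eventually (\<lambda>w. poly (poly Q [:of_real (g w):]) (of_real w) = 0) (at_left 1)"
  shows False
proof -
  obtain m R where R: "Q = smult ([:- 1, 1:] ^ m) R" "\<exists>i. poly (coeff R i) 1 \<noteq> 0"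
    using poly_poly_extract_root[OF Q, of 1] by auto
  define d where "d = degree R"
  define I where "I = {i. i \<le> d \<and> poly (coeff R i) 1 \<noteq> 0}"
  have "finite I" by (simp add: I_def)
  have inI: "i \<in> I" if "poly (coeff R i) 1 \<noteq> 0" for i
  proof -
    have "coeff R i \<noteq> 0" using that by auto
    then show ?thesis using that le_degree[of R i] by (simp add: I_def d_def)
  qed
  then have "I \<noteq> {}" using R(2) by blast
  define J where "J = Max I"
  have J: "J \<in> I" "\<And>i. i \<in> I \<Longrightarrow> i \<le> J" unfolding J_def using \<open>finite I\<close> \<open>I \<noteq> {}\<close> by auto
  have g1: "eventually (\<lambda>w. g w > 0) (at_left 1)"
    using g by (simp add: filterlim_at_top_dense)
  have lt1: "eventually (\<lambda>w::real. w < 1) (at_left 1)" by (simp add: eventually_at_filter)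
  have lim1: "((\<lambda>w. poly p (complex_of_real w)) \<longlongrightarrow> poly p 1) (at_left 1)" for p
  proof -
    have "((\<lambda>w. complex_of_real w) \<longlongrightarrow> complex_of_real 1) (at_left 1)"
      by (intro tendsto_of_real tendsto_ident_at)
    then have "((\<lambda>w. complex_of_real w) \<longlongrightarrow> 1) (at_left 1)" by simp
    then show ?thesis unfolding poly_altdef by (intro tendsto_sum tendsto_mult tendsto_const tendsto_power)
  qed
  have inv: "((\<lambda>w. inverse (g w)) \<longlongrightarrow> 0) (at_left 1)"
    using g by (intro tendsto_inverse_0_at_top)
  have lim_term: "((\<lambda>w. poly (coeff R i) (of_real w) * complex_of_real (g w) ^ i / complex_of_real (g w) ^ J) \<longlongrightarrow>
      (if i = J then poly (coeff R J) 1 else 0)) (at_left 1)" for i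
  proof -
    consider "i < J" | "i = J" | "i > J" by linarith
    then show ?thesis
    proof cases
      case 1
      have "((\<lambda>w. poly (coeff R i) (of_real w) * complex_of_real (inverse (g w) ^ (J - i))) \<longlongrightarrow>
          poly (coeff R i) 1 * complex_of_real (0 ^ (J - i))) (at_left 1)"
        by (intro tendsto_mult lim1 tendsto_of_real tendsto_power inv)
      moreover have "eventually (\<lambda>w. poly (coeff R i) (of_real w) * complex_of_real (inverse (g w) ^ (J - i)) =
          poly (coeff R i) (of_real w) * complex_of_real (g w) ^ i / complex_of_real (g w) ^ J) (at_left 1)"
        using g1
      proof eventually_elim
        case (elim w)
        have "complex_of_real (g w) ^ J = complex_of_real (g w) ^ (J - i) * complex_of_real (g w) ^ i"
          using 1 by (simp flip: power_add)
        then show ?case using elim by (simp add: divide_inverse power_inverse)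
      qed
      ultimately have "((\<lambda>w. poly (coeff R i) (of_real w) * complex_of_real (g w) ^ i / complex_of_real (g w) ^ J) \<longlongrightarrow>
          poly (coeff R i) 1 * complex_of_real (0 ^ (J - i))) (at_left 1)"
        by (rule Lim_transform_eventually)
      then show ?thesis using 1 by (simp add: power_0_left)
    next
      case 2
      have "eventually (\<lambda>w. poly (coeff R i) (of_real w) =
          poly (coeff R i) (of_real w) * complex_of_real (g w) ^ i / complex_of_real (g w) ^ J) (at_left 1)"
        using g1 by eventually_elim (simp add: 2)
      then show ?thesis using Lim_transform_eventually[OF lim1[of "coeff R i"]] 2 by simp
    next
      case 3
      then have "poly (coeff R i) 1 = 0"
        using J(2)[OF inI[of i]] by linarith
      then obtain e where e: "coeff R i = [:-1, 1:] * e" unfolding poly_eq_0_iff_dvd by (elim dvdE)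
      have "((\<lambda>w. - (poly e (of_real w) * complex_of_real ((1 - w) * g w ^ (i - J)))) \<longlongrightarrow>
          - (poly e 1 * complex_of_real 0)) (at_left 1)"
        by (intro tendsto_minus tendsto_mult lim1 tendsto_of_real slow)
      moreover have "eventually (\<lambda>w. - (poly e (of_real w) * complex_of_real ((1 - w) * g w ^ (i - J))) =
          poly (coeff R i) (of_real w) * complex_of_real (g w) ^ i / complex_of_real (g w) ^ J) (at_left 1)"
        using g1
      proof eventually_elim
        case (elim w)
        have "complex_of_real (g w) ^ i = complex_of_real (g w) ^ (i - J) * complex_of_real (g w) ^ J"
          using 3 by (simp flip: power_add)
        then show ?case using elim by (simp add: e) (simp add: algebra_simps)
      qed
      ultimately have "((\<lambda>w. poly (coeff R i) (of_real w) * complex_of_real (g w) ^ i / complex_of_real (g w) ^ J) \<longlongrightarrow>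
          - (poly e 1 * complex_of_real 0)) (at_left 1)"
        by (rule Lim_transform_eventually)
      then show ?thesis using 3 by simp
    qed
  qed
  have "((\<lambda>w. \<Sum>i\<le>d. poly (coeff R i) (of_real w) * complex_of_real (g w) ^ i / complex_of_real (g w) ^ J) \<longlongrightarrow>
      (\<Sum>i\<le>d. if i = J then poly (coeff R J) 1 else 0)) (at_left 1)"
    by (intro tendsto_sum lim_term)
  moreover have "eventually (\<lambda>w. (\<Sum>i\<le>d. poly (coeff R i) (of_real w) * complex_of_real (g w) ^ i / complex_of_real (g w) ^ J) = 0) (at_left 1)"
    using zero lt1
  proof eventually_elim
    case (elim w)
    have "complex_of_real w \<noteq> 1" using elim(2) by simp
    moreover have "poly (poly Q [:of_real (g w):]) (of_real w) =
        (of_real w - 1) ^ m * poly (poly R [:of_real (g w):]) (complex_of_real w)"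
      by (simp add: R(1) poly_power)
    ultimately have "poly (poly R [:of_real (g w):]) (complex_of_real w) = 0" using elim(1) by simp
    then show ?case by (simp add: poly_poly_altdef d_def flip: sum_divide_distrib)
  qed
  ultimately have "((\<lambda>w::real. 0::complex) \<longlongrightarrow> (\<Sum>i\<le>d. if i = J then poly (coeff R J) 1 else 0)) (at_left 1)"
    by (rule Lim_transform_eventually)
  then have "(\<Sum>i\<le>d. if i = J then poly (coeff R J) 1 else 0) = 0"
    by (simp add: tendsto_const_iff)
  moreover have "J \<le> d" "poly (coeff R J) 1 \<noteq> 0" using J(1) by (auto simp: I_def)
  ultimately show False by (simp add: sum.delta)
qed

text \<open>
  The quotient by $(1-w)^3$ of the error of the quadratic Taylor polynomial of $w^n$ at 1.
  The recursion shows that it is a polynomial with nonnegative coefficients.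
\<close>

fun taylor_rem :: "nat \<Rightarrow> real \<Rightarrow> real" where
  "taylor_rem 0 w = 0"
| "taylor_rem (Suc n) w = w * taylor_rem n w + real (n choose 2)"

lemma taylor_rem_eq:
  "(1 - w) ^ 3 * taylor_rem n w = 1 - real n * (1 - w) + real (n choose 2) * (1 - w)\<^sup>2 - w ^ n"
proof (induction n)
  case (Suc n)
  have c: "real (Suc n choose 2) = real (n choose 2) + real n" by (simp add: numeral_2_eq_2)
  have "(1 - w) ^ 3 * taylor_rem (Suc n) w = w * ((1 - w) ^ 3 * taylor_rem n w) + (1 - w) ^ 3 * real (n choose 2)"
    by (simp add: algebra_simps)
  also have "\<dots> = 1 - real (Suc n) * (1 - w) + real (Suc n choose 2) * (1 - w)\<^sup>2 - w ^ Suc n"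
    unfolding Suc c by (simp add: power2_eq_square power3_eq_cube) (simp add: algebra_simps)
  finally show ?case .
qed simp

lemma taylor_rem_nonneg: "0 \<le> w \<Longrightarrow> 0 \<le> taylor_rem n w"
  by (induction n) auto

lemma taylor_rem_1: "taylor_rem n 1 = real (n choose 3)"
  by (induction n) (simp_all add: numeral_3_eq_3 numeral_2_eq_2)

lemma continuous_taylor_rem: "continuous_on UNIV (taylor_rem n)"
  by (induction n) (auto intro!: continuous_intros)

lemma real_choose_2: "real (n choose 2) * 2 = real n * (real n - 1)"
  by (induction n) (simp_all add: numeral_2_eq_2 algebra_simps)

lemma real_choose_3: "real (n choose 3) * 6 = real n * (real n - 1) * (real n - 2)"
proof (induction n)
  case (Suc n)
  have "real (Suc n choose 3) * 6 = 3 * (real (n choose 2) * 2) + real (n choose 3) * 6"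
    by (simp add: numeral_3_eq_3 numeral_2_eq_2)
  then show ?case unfolding Suc real_choose_2 by (simp add: algebra_simps)
qed simp

lemma choose_2_le: "real (n choose 2) \<le> real n ^ 2"
proof -
  have "real (n choose 2) * 2 = real n ^ 2 - real n"
    unfolding real_choose_2 by (simp add: power2_eq_square algebra_simps)
  moreover have "0 \<le> real n ^ 2" by simp
  ultimately show ?thesis by linarith
qed

text \<open>The geometric sum is at most n and at most 1/(1-w). The first bound is better for small
  n, the second for large n, and \<open>log_part_slow\<close> interpolates between them.\<close>

lemma taylor_rem_le:
  assumes "0 \<le> w" "w < 1"
  shows "taylor_rem n w \<le> real n ^ 2 * real n" "taylor_rem n w \<le> real n ^ 2 * (1 / (1 - w))"
proof -
  have "taylor_rem n w \<le> real n ^ 2 * (\<Sum>i<n. w ^ i)"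
  proof (induction n)
    case (Suc n)
    have "taylor_rem (Suc n) w \<le> w * (real n ^ 2 * (\<Sum>i<n. w ^ i)) + real n ^ 2 * 1"
      unfolding taylor_rem.simps mult_1_right by (intro add_mono mult_left_mono Suc assms(1) choose_2_le)
    also have "\<dots> = real n ^ 2 * (\<Sum>i<Suc n. w ^ i)"
    proof -
      have "(\<Sum>i<n. w ^ Suc i) = w * (\<Sum>i<n. w ^ i)" by (simp add: sum_distrib_left)
      then show ?thesis unfolding sum.lessThan_Suc_shift by (simp only: power_0) (simp add: algebra_simps)
    qed
    also have "\<dots> \<le> real (Suc n) ^ 2 * (\<Sum>i<Suc n. w ^ i)"
      using assms by (intro mult_right_mono sum_nonneg power_mono) auto
    finally show ?case .
  qed simp
  note h = this
  have "(\<Sum>i<n. w ^ i) \<le> (\<Sum>i<n. 1)" using assms by (intro sum_mono power_le_one) auto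
  then have 1: "(\<Sum>i<n. w ^ i) \<le> real n" by simp
  have 2: "(\<Sum>i<n. w ^ i) \<le> 1 / (1 - w)"
    using assms by (simp add: sum_gp_strict divide_right_mono)
  show "taylor_rem n w \<le> real n ^ 2 * real n"
    by (rule order.trans[OF h mult_left_mono[OF 1 zero_le_power2]])
  show "taylor_rem n w \<le> real n ^ 2 * (1 / (1 - w))"
    by (rule order.trans[OF h mult_left_mono[OF 2 zero_le_power2]])
qed

section \<open>Power series with coefficients of order n^(-4)\<close>

context
  fixes \<alpha> :: "nat \<Rightarrow> real" and c C :: real
  assumes pos: "c > 0"
    and lower: "\<And>n. n > 0 \<Longrightarrow> c / (real n + 1) ^ 4 \<le> \<alpha> n"
    and upper: "\<And>n. \<alpha> n \<le> C / (real n + 1) ^ 4"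
    and nonneg: "\<And>n. 0 \<le> \<alpha> n"
begin

lemma C_nonneg: "C \<ge> 0"
  using upper[of 0] nonneg[of 0] by simp

text \<open>Quadratic weights leave terms of order n^(-2). This covers the three Taylor coefficients
  at 1 and, for fixed w < 1, the remainder.\<close>

lemma weighted_summable:
  assumes "\<And>n. \<bar>b n\<bar> \<le> K * (real n + 1) ^ 2"
  shows "summable (\<lambda>n. \<alpha> n * b n)"
proof (rule summable_comparison_test')
  show "summable (\<lambda>n. K * C * (1 / (real (Suc n)) ^ 2))"
  proof (rule summable_mult)
    have "summable (\<lambda>n. 1 / real n ^ 2)"
      using inverse_power_summable[of 2, where 'a = real] by (simp add: inverse_eq_divide)
    then show "summable (\<lambda>n. 1 / real (Suc n) ^ 2)" by (subst summable_Suc_iff)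
  qed
  fix n
  define N where "N = real n + 1"
  have N: "N \<ge> 1" "real n \<le> N" by (simp_all add: N_def)
  have "norm (\<alpha> n * b n) = \<alpha> n * \<bar>b n\<bar>" using nonneg by (simp add: abs_mult)
  also have "\<dots> \<le> C / N ^ 4 * (K * N ^ 2)"
    using upper[of n] nonneg[of n] assms[of n] C_nonneg N unfolding N_def
    by (intro mult_mono divide_nonneg_pos) auto
  also have "\<dots> = K * C * (1 / N ^ 2)" using N by (simp add: field_simps eval_nat_numeral)
  finally show "norm (\<alpha> n * b n) \<le> K * C * (1 / real (Suc n) ^ 2)" by (simp add: N_def add.commute)
qed

definition log_part :: "real \<Rightarrow> real" where
  "log_part w = (\<Sum>n. \<alpha> n * taylor_rem n w)"

lemma summable_const: "summable \<alpha>"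
  using weighted_summable[of "\<lambda>_. 1" 1] by simp

lemma log_part_summable: "0 \<le> w \<Longrightarrow> w < 1 \<Longrightarrow> summable (\<lambda>n. \<alpha> n * taylor_rem n w)"
proof (rule weighted_summable)
  fix n assume w: "0 \<le> w" "w < 1"
  have "\<bar>taylor_rem n w\<bar> \<le> real n ^ 2 * (1 / (1 - w))"
    using taylor_rem_le(2)[OF w] taylor_rem_nonneg[OF w(1)] by simp
  also have "\<dots> \<le> (real n + 1) ^ 2 * (1 / (1 - w))"
    using w by (intro mult_right_mono power_mono) auto
  finally show "\<bar>taylor_rem n w\<bar> \<le> 1 / (1 - w) * (real n + 1) ^ 2" by (simp only: mult.commute)
qed

lemma log_part_eq:
  assumes "0 \<le> w" "w < 1"
  shows "(\<Sum>n. \<alpha> n * w ^ n) = (\<Sum>n. \<alpha> n) - (\<Sum>n. \<alpha> n * real n) * (1 - w)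
    + (\<Sum>n. \<alpha> n * real (n choose 2)) * (1 - w)\<^sup>2 - (1 - w) ^ 3 * log_part w"
proof -
  have 1: "summable (\<lambda>n. \<alpha> n * real n)"
    by (rule weighted_summable[of _ 1]) (simp add: power2_eq_square algebra_simps)
  have 2: "summable (\<lambda>n. \<alpha> n * real (n choose 2))"
  proof (rule weighted_summable[of _ 1])
    fix n
    have "real n ^ 2 \<le> (real n + 1) ^ 2" by (intro power_mono) auto
    then show "\<bar>real (n choose 2)\<bar> \<le> 1 * (real n + 1) ^ 2" using choose_2_le[of n] by linarith
  qed
  have "(\<lambda>n. \<alpha> n - \<alpha> n * real n * (1 - w) + \<alpha> n * real (n choose 2) * (1 - w)\<^sup>2 - (1 - w) ^ 3 * (\<alpha> n * taylor_rem n w)) sums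
    ((\<Sum>n. \<alpha> n) - (\<Sum>n. \<alpha> n * real n) * (1 - w) + (\<Sum>n. \<alpha> n * real (n choose 2)) * (1 - w)\<^sup>2 - (1 - w) ^ 3 * log_part w)"
    unfolding log_part_def
    by (intro sums_diff sums_add sums_mult sums_mult2 summable_sums summable_const 1 2 log_part_summable assms)
  moreover have "\<alpha> n - \<alpha> n * real n * (1 - w) + \<alpha> n * real (n choose 2) * (1 - w)\<^sup>2 - (1 - w) ^ 3 * (\<alpha> n * taylor_rem n w) = \<alpha> n * w ^ n" for n
    unfolding mult.left_commute[of "(1 - w) ^ 3"] taylor_rem_eq by (simp add: algebra_simps)
  ultimately show ?thesis by (simp add: sums_iff)
qed

text \<open>At w = 1 the terms become \<open>\<alpha> n * real (n choose 3)\<close>, which dominate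
  a harmonic series. A large partial sum stays large near 1 by continuity and bounds
  \<open>log_part\<close> from below.\<close>

lemma log_part_at_top: "filterlim log_part at_top (at_left 1)"
  unfolding filterlim_at_top_dense
proof
  fix K :: real
  have "\<exists>N. (\<Sum>n<N. \<alpha> n * real (n choose 3)) > K"
  proof (rule ccontr)
    assume "\<nexists>N. (\<Sum>n<N. \<alpha> n * real (n choose 3)) > K"
    then have "summable (\<lambda>n. \<alpha> n * real (n choose 3))"
      by (intro summableI_nonneg_bounded[of _ K]) (auto simp: nonneg not_less)
    then have s1: "summable (\<lambda>n. \<alpha> (n + 3) * real (n + 3 choose 3))" by (rule summable_ignore_initial_segment)
    \<comment> \<open>The constant is 1536 = 4^4 * 6, from n + 4 \<le> 4(n + 1) and the 3! in the
      binomial coefficient.\<close>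
    have s2: "norm (c / 1536 * (1 / real (Suc n))) \<le> \<alpha> (n + 3) * real (n + 3 choose 3)" for n
    proof -
      define x where "x = real n + 1"
      have x: "x \<ge> 1" by (simp add: x_def)
      have "real (n + 3 choose 3) * 6 = (real n + 1) * (real n + 2) * (real n + 3)"
        unfolding real_choose_3 by (simp add: algebra_simps)
      moreover have "x * x * x \<le> (real n + 1) * (real n + 2) * (real n + 3)"
        unfolding x_def by (intro mult_mono) auto
      ultimately have b: "real (n + 3 choose 3) \<ge> x ^ 3 / 6" by (simp add: power3_eq_cube)
      have "c / (4 * x) ^ 4 \<le> c / (real (n + 3) + 1) ^ 4"
        using pos by (intro divide_left_mono power_mono) (auto simp: x_def)
      then have a: "c / (4 * x) ^ 4 \<le> \<alpha> (n + 3)" using lower[of "n + 3"] by linarith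
      have "c / 1536 * (1 / x) = c / (4 * x) ^ 4 * (x ^ 3 / 6)"
        using x by (simp add: field_simps eval_nat_numeral)
      also have "\<dots> \<le> \<alpha> (n + 3) * real (n + 3 choose 3)"
        using x by (intro mult_mono a b nonneg) auto
      finally show ?thesis using pos x by (simp add: x_def add.commute)
    qed
    have "summable (\<lambda>n. c / 1536 * (1 / real (Suc n)))"
      by (rule summable_comparison_test'[OF s1 s2])
    moreover have "c / 1536 \<noteq> 0" using pos by simp
    ultimately have "summable (\<lambda>n. 1 / real (Suc n))" unfolding summable_cmult_iff by blast
    then have "summable (\<lambda>n. 1 / real n)" by (subst (asm) summable_Suc_iff)
    then show False using not_summable_harmonic[where 'a = real] by (simp add: inverse_eq_divide)
  qed
  then obtain N where N: "(\<Sum>n<N. \<alpha> n * taylor_rem n 1) > K" by (auto simp: taylor_rem_1)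
  have "((\<lambda>w. \<Sum>n<N. \<alpha> n * taylor_rem n w) \<longlongrightarrow> (\<Sum>n<N. \<alpha> n * taylor_rem n 1)) (at_left 1)"
  proof (intro tendsto_sum tendsto_mult tendsto_const)
    fix n
    have "isCont (taylor_rem n) 1" using continuous_taylor_rem by (simp add: continuous_on_eq_continuous_at)
    then show "(taylor_rem n \<longlongrightarrow> taylor_rem n 1) (at_left 1)"
      by (simp add: isCont_def filterlim_at_split)
  qed
  then have "eventually (\<lambda>w. (\<Sum>n<N. \<alpha> n * taylor_rem n w) > K) (at_left 1)"
    using N by (rule order_tendstoD)
  moreover have "eventually (\<lambda>w::real. w \<in> {0<..<1}) (at_left 1)"
    by (rule eventually_at_leftI[of 0]) auto
  ultimately show "eventually (\<lambda>w. K < log_part w) (at_left 1)"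
  proof eventually_elim
    case (elim w)
    have "(\<Sum>n<N. \<alpha> n * taylor_rem n w) \<le> log_part w"
      unfolding log_part_def using elim(2)
      by (intro sum_le_suminf log_part_summable) (auto intro!: mult_nonneg_nonneg nonneg taylor_rem_nonneg)
    then show ?case using elim(1) by simp
  qed
qed

lemma log_part_slow: "((\<lambda>w. (1 - w) * log_part w ^ k) \<longlongrightarrow> 0) (at_left 1)"
proof -
  \<comment> \<open>This choice leaves the positive exponent 1 - k \<epsilon> at the end, and
    \<epsilon> \<le> 1 keeps the exponent 1 - \<epsilon> below nonnegative.\<close>
  define \<epsilon> where "\<epsilon> = 1 / (real k + 1)"
  have \<epsilon>: "\<epsilon> > 0" "\<epsilon> \<le> 1" "real k * \<epsilon> < 1" by (simp_all add: \<epsilon>_def field_simps)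
  define D where "D = (\<Sum>n. C * real (Suc n) powr (- 1 - \<epsilon>))"
  have sD: "summable (\<lambda>n. C * real (Suc n) powr (- 1 - \<epsilon>))"
  proof (rule summable_mult)
    have "summable (\<lambda>n. real n powr (- 1 - \<epsilon>))" using \<epsilon> by (simp add: summable_real_powr_iff)
    then show "summable (\<lambda>n. real (Suc n) powr (- 1 - \<epsilon>))" by (subst summable_Suc_iff)
  qed
  have bound: "log_part w \<le> D * (1 - w) powr (- \<epsilon>)" if w: "0 \<le> w" "w < 1" for w
  proof -
    have "\<alpha> n * taylor_rem n w \<le> C * real (Suc n) powr (- 1 - \<epsilon>) * (1 - w) powr (- \<epsilon>)" for n
    proof -
      define N u where "N = real (Suc n)" and "u = 1 - w"
      have N: "N \<ge> 1" "real n \<le> N" and u: "u > 0" using w by (simp_all add: N_def u_def)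
      have "taylor_rem n w \<le> N ^ 2 * min N (1 / u)"
      proof -
        have "taylor_rem n w \<le> real n ^ 2 * min (real n) (1 / u)"
          using taylor_rem_le[OF w, of n] by (simp add: min_def u_def)
        also have "\<dots> \<le> N ^ 2 * min N (1 / u)" using N u by (intro mult_mono power_mono) auto
        finally show ?thesis .
      qed
      \<comment> \<open>The exponent \<open>\<epsilon>\<close> makes the series over \<open>n\<close> converge and costs only a small power of \<open>1 - w\<close>.\<close>
      also have "min N (1 / u) \<le> N powr (1 - \<epsilon>) * u powr (- \<epsilon>)"
      proof -
        define m where "m = min N (1 / u)"
        have m: "m > 0" "m \<le> N" "m \<le> 1 / u" using N u by (auto simp: m_def)
        have "m = m powr (1 - \<epsilon>) * m powr \<epsilon>" using m by (simp flip: powr_add)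
        also have "\<dots> \<le> N powr (1 - \<epsilon>) * (1 / u) powr \<epsilon>"
          using m \<epsilon> by (intro mult_mono powr_mono2) auto
        also have "(1 / u) powr \<epsilon> = u powr (- \<epsilon>)" using u by (simp add: powr_divide powr_minus_divide)
        finally show ?thesis by (simp add: m_def)
      qed
      finally have 1: "taylor_rem n w \<le> N ^ 2 * (N powr (1 - \<epsilon>) * u powr (- \<epsilon>))" using N by simp
      have "\<alpha> n * taylor_rem n w \<le> C / N ^ 4 * (N ^ 2 * (N powr (1 - \<epsilon>) * u powr (- \<epsilon>)))"
        using upper[of n] 1 nonneg taylor_rem_nonneg[OF w(1)] C_nonneg N
        by (intro mult_mono) (auto simp: N_def add.commute)
      also have "\<dots> = C * (N powr (-4) * N powr 2 * N powr (1 - \<epsilon>)) * u powr (- \<epsilon>)"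
        using N by (simp add: powr_minus_divide powr_numeral)
      also have "N powr (-4) * N powr 2 * N powr (1 - \<epsilon>) = N powr (- 1 - \<epsilon>)"
        by (simp flip: powr_add)
      finally show ?thesis by (simp add: N_def u_def)
    qed
    then have "log_part w \<le> (\<Sum>n. C * real (Suc n) powr (- 1 - \<epsilon>) * (1 - w) powr (- \<epsilon>))"
      unfolding log_part_def by (intro suminf_le log_part_summable w summable_mult2 sD)
    also have "\<dots> = D * (1 - w) powr (- \<epsilon>)" unfolding D_def by (rule suminf_mult2[symmetric, OF sD])
    finally show ?thesis .
  qed
  have nn: "0 \<le> log_part w" if "0 \<le> w" "w < 1" for w
    unfolding log_part_def
    by (intro suminf_nonneg log_part_summable that mult_nonneg_nonneg nonneg taylor_rem_nonneg)
  have ev: "eventually (\<lambda>w::real. w \<in> {0<..<1}) (at_left 1)"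
    by (rule eventually_at_leftI[of 0]) auto
  show ?thesis
  proof (rule tendsto_sandwich)
    show "eventually (\<lambda>w. 0 \<le> (1 - w) * log_part w ^ k) (at_left 1)"
      using ev by eventually_elim (auto intro!: mult_nonneg_nonneg zero_le_power nn)
    show "eventually (\<lambda>w. (1 - w) * log_part w ^ k \<le> D ^ k * (1 - w) powr (1 - real k * \<epsilon>)) (at_left 1)"
      using ev
    proof eventually_elim
      case (elim w)
      then have "(1 - w) * log_part w ^ k \<le> (1 - w) * (D * (1 - w) powr (- \<epsilon>)) ^ k"
        by (intro mult_left_mono power_mono bound nn) auto
      also have "\<dots> = D ^ k * ((1 - w) powr 1 * (1 - w) powr (- (real k * \<epsilon>)))"
        using elim by (simp add: power_mult_distrib powr_power mult_ac)
      also have "\<dots> = D ^ k * (1 - w) powr (1 - real k * \<epsilon>)" unfolding powr_add[symmetric] by simp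
      finally show ?case .
    qed
    have "((\<lambda>w::real. (1 - w) powr (1 - real k * \<epsilon>)) \<longlongrightarrow> 0) (at_left 1)"
    proof (rule tendsto_zero_powrI[where b = "1 - real k * \<epsilon>"])
      show "((\<lambda>w::real. 1 - w) \<longlongrightarrow> 0) (at_left 1)" by (auto intro!: tendsto_eq_intros)
      show "eventually (\<lambda>w::real. 0 \<le> 1 - w) (at_left 1)" using ev by eventually_elim auto
    qed (use \<epsilon> in auto)
    then show "((\<lambda>w::real. D ^ k * (1 - w) powr (1 - real k * \<epsilon>)) \<longlongrightarrow> 0) (at_left 1)"
      by (rule tendsto_mult_right_zero)
  qed simp
qed

end

section \<open>Two-sided bounds for the avoiders\<close>

lemma rising4_ge: "(real n + 1) ^ 4 \<le> rising4 n"
  unfolding rising4_def power4_eq_xxxx by (intro mult_mono) auto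

lemma rising4_le: "rising4 n \<le> 16 * (real n + 2) ^ 4"
proof -
  have "rising4 n \<le> (2 * (real n + 2)) * (2 * (real n + 2)) * (2 * (real n + 2)) * (2 * (real n + 2))"
    unfolding rising4_def by (intro mult_mono) auto
  also have "\<dots> = 16 * (real n + 2) ^ 4" unfolding power4_eq_xxxx by (simp only: mult_ac)
  finally show ?thesis .
qed

lemma card_Av_A55_upper: "real (card (Av n A55)) / 10 ^ n \<le> 24 * 10 ^ 4 / 9 ^ 4 / (real n + 1) ^ 4"
proof -
  have "real (card (Av n A55)) \<le> real (\<Sum>m\<le>n. (n choose m) * card (inc_avoiders 4 m))"
    using card_Av_A55_le by (simp only: of_nat_le_iff)
  also have "\<dots> = binomial_avoiders n" by (simp add: binomial_avoiders_def num_avoiders_def)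
  also have "\<dots> \<le> 24 * (10 ^ (n + 4) / 9 ^ 4) / rising4 n"
    using binomial_avoiders_upper[of n] rising4_pos[of n] by (subst pos_le_divide_eq) simp_all
  also have "\<dots> \<le> 24 * (10 ^ (n + 4) / 9 ^ 4) / (real n + 1) ^ 4"
    using rising4_ge[of n] rising4_pos[of n] by (intro divide_left_mono mult_pos_pos) auto
  finally show ?thesis by (simp add: power_add field_simps)
qed

text \<open>The 16 in \<open>rising4_le\<close> turns 16/27 into 1/27, and passing from n to n - 1
  costs another factor 10. The latter step also excludes n = 0.\<close>

lemma card_Av_A55_lower:
  assumes "n > 0"
  shows "1 / 270 / (real n + 1) ^ 4 \<le> real (card (Av n A55)) / 10 ^ n"
proof -
  obtain m where n: "n = Suc m" using assms by (cases n) auto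
  have "1 / 27 / (real m + 2) ^ 4 * 10 ^ m = 16 / 27 * 10 ^ m / (16 * (real m + 2) ^ 4)" by simp
  also have "\<dots> \<le> 16 / 27 * 10 ^ m / rising4 m"
    using rising4_le[of m] rising4_pos[of m] by (intro divide_left_mono mult_pos_pos) auto
  also have "\<dots> \<le> binomial_avoiders m"
    using binomial_avoiders_lower[of m] rising4_pos[of m] by (subst pos_divide_le_eq) simp_all
  also have "\<dots> = real (\<Sum>k\<le>m. (m choose k) * card (inc_avoiders 4 k))"
    by (simp add: binomial_avoiders_def num_avoiders_def)
  also have "\<dots> \<le> real (card (Av n A55))" unfolding n using card_Av_A55_ge by (simp only: of_nat_le_iff)
  finally show ?thesis by (simp add: n field_simps)
qed

section \<open>The generating function\<close>

text \<open>Carries the formal equation over to values. Convergence is proved along with it, because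
  evaluating a sum requires convergence of its parts.\<close>

lemma eval_fps_polynomial:
  fixes F :: "complex fps"
  assumes "norm z < fps_conv_radius F"
  shows "norm z < fps_conv_radius (\<Sum>j\<le>d. fps_of_poly (P j) * F ^ j) \<and>
    eval_fps (\<Sum>j\<le>d. fps_of_poly (P j) * F ^ j) z = (\<Sum>j\<le>d. poly (P j) z * eval_fps F z ^ j)"
proof -
  have pw: "norm z < fps_conv_radius (F ^ j)" for j
    using assms fps_conv_radius_power[of F j] by (rule less_le_trans)
  have t: "norm z < fps_conv_radius (fps_of_poly (P j) * F ^ j)" for j
    using fps_conv_radius_mult[of "fps_of_poly (P j)" "F ^ j"] pw[of j] by (auto intro: less_le_trans)
  have e: "eval_fps (fps_of_poly (P j) * F ^ j) z = poly (P j) z * eval_fps F z ^ j" for j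
    using assms pw[of j] by (simp add: eval_fps_mult eval_fps_power)
  show ?thesis
  proof (induction d)
    case 0
    show ?case using t[of 0] e[of 0] by simp
  next
    case (Suc d)
    have "norm z < fps_conv_radius ((\<Sum>j\<le>d. fps_of_poly (P j) * F ^ j) + fps_of_poly (P (Suc d)) * F ^ Suc d)"
      using Suc t[of "Suc d"] by (intro less_le_trans[OF _ fps_conv_radius_add]) (simp only: min_less_iff_conj)
    moreover have "eval_fps ((\<Sum>j\<le>d. fps_of_poly (P j) * F ^ j) + fps_of_poly (P (Suc d)) * F ^ Suc d) z =
      (\<Sum>j\<le>d. poly (P j) z * eval_fps F z ^ j) + poly (P (Suc d)) z * eval_fps F z ^ Suc d"
      using Suc t[of "Suc d"] e[of "Suc d"] by (subst eval_fps_add) (simp_all only:)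
    ultimately show ?case by (simp only: sum.atMost_Suc)
  qed
qed

theorem theorem10: "\<not> fps_algebraic (Av_gf A55)"
proof
  assume "fps_algebraic (Av_gf A55)"
  then obtain d P where P: "\<exists>j\<le>d. P j \<noteq> 0" "(\<Sum>j\<le>d. fps_of_poly (P j) * Av_gf A55 ^ j) = 0"
    unfolding fps_algebraic_def by blast
  define \<alpha> where "\<alpha> n = real (card (Av n A55)) / 10 ^ n" for n
  have pos: "1 / 270 > (0::real)" by simp
  have lower: "1 / 270 / (real n + 1) ^ 4 \<le> \<alpha> n" if "n > 0" for n
    using card_Av_A55_lower[OF that] by (simp only: \<alpha>_def)
  have upper: "\<alpha> n \<le> 24 * 10 ^ 4 / 9 ^ 4 / (real n + 1) ^ 4" for n
    using card_Av_A55_upper by (simp only: \<alpha>_def)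
  have nonneg: "0 \<le> \<alpha> n" for n by (simp add: \<alpha>_def)
  note log = pos lower upper nonneg
  define f where "f w = (\<Sum>n. \<alpha> n * w ^ n)" for w
  have sum_f: "summable (\<lambda>n. \<alpha> n * w ^ n)" if w: "0 \<le> w" "w < 1" for w
  proof (rule summable_comparison_test'[OF summable_const[OF log]])
    fix n
    show "norm (\<alpha> n * w ^ n) \<le> \<alpha> n"
      using mult_left_mono[OF power_le_one[of w n] nonneg[of n]] w nonneg by (simp add: abs_mult)
  qed
  have nth: "fps_nth (Av_gf A55) n = of_real (10 ^ n * \<alpha> n)" for n
    by (simp add: Av_gf_def \<alpha>_def)
  have radius: "fps_conv_radius (Av_gf A55) \<ge> norm (1 / 10 :: complex)"
    unfolding fps_conv_radius_def
  proof (rule conv_radius_geI)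
    have "fps_nth (Av_gf A55) n * (1 / 10) ^ n = complex_of_real (\<alpha> n)" for n
      by (simp add: nth power_one_over)
    then show "summable (\<lambda>n. fps_nth (Av_gf A55) n * (1 / 10) ^ n)"
      using summable_const[OF log] by (simp add: summable_of_real)
  qed
  have root: "(\<Sum>j\<le>d. poly (P j) (of_real (w / 10)) * complex_of_real (f w) ^ j) = 0" if w: "0 < w" "w < 1" for w
  proof -
    define z where "z = complex_of_real (w / 10)"
    have "norm z < norm (1 / 10 :: complex)" using w by (simp add: z_def norm_divide)
    then have "norm z < fps_conv_radius (Av_gf A55)" using radius by (metis ereal_less_eq(3) ereal_less(2) less_ereal.simps(1) less_le_trans)
    from eval_fps_polynomial[OF this, of P d]
    have "(\<Sum>j\<le>d. poly (P j) z * eval_fps (Av_gf A55) z ^ j) = 0" by (simp add: P(2))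
    moreover have "eval_fps (Av_gf A55) z = of_real (f w)"
    proof -
      have "fps_nth (Av_gf A55) n * z ^ n = complex_of_real (\<alpha> n * w ^ n)" for n
        by (simp add: nth z_def power_divide)
      then show ?thesis unfolding eval_fps_def f_def using sum_f[of w] w by (simp add: suminf_of_real)
    qed
    ultimately show ?thesis by (simp add: z_def)
  qed
  \<comment> \<open>The inner variable is w = 10 z, which moves the singularity to 1; the outer one
    stands for the generating function.\<close>
  define Q where "Q = (\<Sum>j\<le>d. monom (pcompose (P j) [:0, 1 / 10:]) j)"
  have coeff_Q: "coeff Q j = (if j \<le> d then pcompose (P j) [:0, 1 / 10:] else 0)" for j
    by (simp add: Q_def coeff_sum sum.delta)
  obtain j where j: "j \<le> d" "P j \<noteq> 0" using P(1) by blast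
  then have "coeff Q j \<noteq> 0" using pcompose_eq_0[of "P j" "[:0, 1 / 10:]"] by (auto simp: coeff_Q)
  then have "Q \<noteq> 0" by auto
  have poly_Q: "poly (poly Q [:y:]) w = (\<Sum>j\<le>d. poly (P j) (w / 10) * y ^ j)" for y w
  proof -
    have "poly (poly Q [:y:]) w = (\<Sum>j\<le>d. poly (pcompose (P j) [:0, 1 / 10:] * [:y:] ^ j) w)"
      by (simp only: Q_def poly_sum poly_monom)
    also have "\<dots> = (\<Sum>j\<le>d. poly (P j) (w / 10) * y ^ j)"
      by (rule sum.cong[OF refl])
        (simp only: poly_mult poly_power poly_pcompose poly_pCons poly_0 mult_zero_right add_0_right add_0_left
          times_divide_eq_right mult_1_right)
    finally show ?thesis .
  qed
  \<comment> \<open>By \<open>log_part_eq\<close> the function is q - (1 - w)^3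
    \<open>log_part\<close>. Putting this into the outer variable gives an equation for
    \<open>log_part\<close>, which is nontrivial because the substituted polynomial has outer degree
    1.\<close>
  define q :: "complex poly" where "q = [:of_real (\<Sum>n. \<alpha> n):] - smult (of_real (\<Sum>n. \<alpha> n * real n)) [:1, -1:]
    + smult (of_real (\<Sum>n. \<alpha> n * real (n choose 2))) ([:1, -1:] ^ 2)"
  define R where "R = pcompose Q [:q, - ([:1, -1:] ^ 3):]"
  have "R \<noteq> 0"
    using pcompose_eq_0[of Q "[:q, - ([:1, -1:] ^ 3):]"] \<open>Q \<noteq> 0\<close> by (auto simp: R_def)
  moreover have "filterlim (log_part \<alpha>) at_top (at_left 1)" by (rule log_part_at_top[OF log])
  moreover have "((\<lambda>w. (1 - w) * log_part \<alpha> w ^ k) \<longlongrightarrow> 0) (at_left 1)" for k by (rule log_part_slow[OF log])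
  moreover have "eventually (\<lambda>w. poly (poly R [:of_real (log_part \<alpha> w):]) (of_real w) = 0) (at_left 1)"
  proof (rule eventually_at_leftI[of 0])
    fix w :: real assume "w \<in> {0<..<1}"
    then have w: "0 < w" "w < 1" by auto
    have "poly (poly R [:of_real (log_part \<alpha> w):]) (of_real w) =
      poly (poly Q (q + [:of_real (log_part \<alpha> w):] * - ([:1, -1:] ^ 3))) (complex_of_real w)"
      by (simp only: R_def poly_pcompose poly_pCons poly_0 mult_zero_right add_0_right)
    also have "\<dots> = poly (poly Q [:poly (q + [:of_real (log_part \<alpha> w):] * - ([:1, -1:] ^ 3)) (of_real w):]) (of_real w)"
      by (rule poly_poly_const)
    also have "poly (q + [:of_real (log_part \<alpha> w):] * - ([:1, -1:] ^ 3)) (complex_of_real w) = of_real (f w)"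
      using log_part_eq[OF log, of w] w by (simp add: q_def f_def) (simp add: algebra_simps)
    also have "poly (poly Q [:of_real (f w):]) (complex_of_real w) = 0"
      unfolding poly_Q using root[OF w] by simp
    finally show "poly (poly R [:of_real (log_part \<alpha> w):]) (complex_of_real w) = 0" .
  qed simp
  ultimately show False by (rule no_algebraic_log_growth)
qed

end
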